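(* Consider the following minimal perfect hash function (ShockHash) for a set $S$ of $n$ keys: for each seed $s\in\mathbb{N}$ there are two independent fully random hash functions $h_{s,0},h_{s,1}:S\to[n]$ (independent across seeds); the construction tries seeds $s=0,1,2,\dots$ and determines the smallest seed $s$ for which there exists $f:S\to\{0,1\}$ such that $x\mapsto h_{s,f(x)}(x)$ is a bijection $S\to[n]$ (checked for each seed in linear time, e.g.\ via connected components, since such $f$ exists iff the multigraph on $[n]$ with edges $\{h_{s,0}(x),h_{s,1}(x)\}$, $x\in S$, is a pseudoforest); it stores the seed $s$ using about $\log_2 s$ bits and stores $f$ in a 1-bit retrieval data structure using $n+o(n)$ bits that can be built in linear time. A query for $x$ returns $h_{s,f(x)}(x)$. Then this minimal perfect hash function uses $\log_2(e)\,n+o(n)$ bits of space in expectation and can be constructed in expected time $\mathcal{O}((e/2)^n\cdot n)$.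
   Context: A minimal perfect hash function on a set $S$ of $n$ keys is a bijection $S\to[n]$, $[n]=\{1,\dots,n\}$. A retrieval data structure for a set $S$ stores a function $S\to\{0,1\}$ (answering arbitrarily on keys outside $S$). A pseudoforest is a multigraph in which every connected component has at most as many edges as nodes. *)

theory Defs
  imports "HOL-Probability.Probability" "HOL-Library.Landau_Symbols" "HOL-Library.Log_Nat"
begin

text \<open>An undirected multigraph (loops and parallel edges allowed) has nodes \<open>V\<close>, edge names
  \<open>E\<close>, and edge \<open>x\<close> joins \<open>a x\<close> and \<open>b x\<close>; all end points are assumed to lie in \<open>V\<close>.\<close>

definition components :: "'v set \<Rightarrow> 'e set \<Rightarrow> ('e \<Rightarrow> 'v) \<Rightarrow> ('e \<Rightarrow> 'v) \<Rightarrow> 'v set set" where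
  "components V E a b = V // ((\<Union>x\<in>E. {(a x, b x), (b x, a x)})\<^sup>*)"

definition pseudoforest :: "'v set \<Rightarrow> 'e set \<Rightarrow> ('e \<Rightarrow> 'v) \<Rightarrow> ('e \<Rightarrow> 'v) \<Rightarrow> bool" where
  "pseudoforest V E a b \<longleftrightarrow>
     (\<forall>C\<in>components V E a b. card {x\<in>E. a x \<in> C \<and> b x \<in> C} \<le> card C)"

text \<open>The bits 0 and 1 are \<open>False\<close> and \<open>True\<close>.  A pair of hash functions for one seed is
  \<open>h :: bool \<Rightarrow> 'k \<Rightarrow> nat\<close>; only its values on \<open>S\<close> matter.\<close>

definition hash_pair :: "'k set \<Rightarrow> (bool \<Rightarrow> 'k \<Rightarrow> nat) \<Rightarrow> bool" where
  "hash_pair S h \<longleftrightarrow> (\<forall>i. h i \<in> S \<rightarrow> {1..card S})"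

definition perfect_choice :: "'k set \<Rightarrow> (bool \<Rightarrow> 'k \<Rightarrow> nat) \<Rightarrow> ('k \<Rightarrow> bool) \<Rightarrow> bool" where
  "perfect_choice S h f \<longleftrightarrow> bij_betw (\<lambda>x. h (f x) x) S {1..card S}"

definition hash_space :: "'k set \<Rightarrow> (nat \<times> bool \<times> 'k \<Rightarrow> nat) measure" where
  "hash_space S = PiM (UNIV \<times> UNIV \<times> S) (\<lambda>_. uniform_count_measure {1..card S})"

definition hashes :: "(nat \<times> bool \<times> 'k \<Rightarrow> nat) \<Rightarrow> nat \<Rightarrow> bool \<Rightarrow> 'k \<Rightarrow> nat" where
  "hashes \<omega> s i x = \<omega> (s, i, x)"

text \<open>The test run on each seed decides whether a perfect choice exists and returns one if so.\<close>

definition seed_test :: "('k set \<Rightarrow> (bool \<Rightarrow> 'k \<Rightarrow> nat) \<Rightarrow> ('k \<Rightarrow> bool) option) \<Rightarrow> bool" where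
  "seed_test test \<longleftrightarrow> (\<forall>S h. finite S \<longrightarrow> hash_pair S h \<longrightarrow>
     (case test S h of
        None \<Rightarrow> \<not> (\<exists>f. perfect_choice S h f)
      | Some f \<Rightarrow> perfect_choice S h f))"

text \<open>A retrieval data structure for \<open>S\<close> is a bit string.  The evaluator \<open>query S\<close> is
  indexed by \<open>S\<close> because it may use hash functions that work for \<open>S\<close> and are not charged to the
  space: over an infinite universe of keys, no evaluator independent of \<open>S\<close> could be correct
  for all \<open>S\<close> with strings whose length is bounded in terms of \<open>card S\<close>.\<close>

definition retrieval ::
  "('k set \<Rightarrow> ('k \<Rightarrow> bool) \<Rightarrow> bool list) \<Rightarrow> ('k set \<Rightarrow> bool list \<Rightarrow> 'k \<Rightarrow> bool) \<Rightarrow> bool" where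
  "retrieval build query \<longleftrightarrow> (\<forall>S f. finite S \<longrightarrow> (\<forall>x\<in>S. query S (build S f) x = f x))"

definition terminates :: "'k set \<Rightarrow> (nat \<times> bool \<times> 'k \<Rightarrow> nat) \<Rightarrow> bool" where
  "terminates S \<omega> \<longleftrightarrow> (\<exists>s f. perfect_choice S (hashes \<omega> s) f)"

definition found_seed :: "'k set \<Rightarrow> (nat \<times> bool \<times> 'k \<Rightarrow> nat) \<Rightarrow> nat" where
  "found_seed S \<omega> = (LEAST s. \<exists>f. perfect_choice S (hashes \<omega> s) f)"

definition found_choice ::
  "('k set \<Rightarrow> (bool \<Rightarrow> 'k \<Rightarrow> nat) \<Rightarrow> ('k \<Rightarrow> bool) option) \<Rightarrow>
   'k set \<Rightarrow> (nat \<times> bool \<times> 'k \<Rightarrow> nat) \<Rightarrow> 'k \<Rightarrow> bool" where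
  "found_choice test S \<omega> = the (test S (hashes \<omega> (found_seed S \<omega>)))"

definition shockhash ::
  "('k set \<Rightarrow> (bool \<Rightarrow> 'k \<Rightarrow> nat) \<Rightarrow> ('k \<Rightarrow> bool) option) \<Rightarrow>
   ('k set \<Rightarrow> ('k \<Rightarrow> bool) \<Rightarrow> bool list) \<Rightarrow>
   'k set \<Rightarrow> (nat \<times> bool \<times> 'k \<Rightarrow> nat) \<Rightarrow> nat \<times> bool list" where
  "shockhash test build S \<omega> = (found_seed S \<omega>, build S (found_choice test S \<omega>))"

definition shockhash_query ::
  "('k set \<Rightarrow> bool list \<Rightarrow> 'k \<Rightarrow> bool) \<Rightarrow>
   'k set \<Rightarrow> (nat \<times> bool \<times> 'k \<Rightarrow> nat) \<Rightarrow> nat \<times> bool list \<Rightarrow> 'k \<Rightarrow> nat" where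
  "shockhash_query query S \<omega> d x = hashes \<omega> (fst d) (query S (snd d) x) x"

text \<open>\<open>floorlog 2 s\<close> is the length of the binary representation of \<open>s\<close>.\<close>

definition stored_bits :: "nat \<times> bool list \<Rightarrow> nat" where
  "stored_bits d = floorlog 2 (fst d) + length (snd d)"

text \<open>Space and time are infinite on the event that no seed works.  \<open>test_cost S h\<close> is all the
  work done for one seed (evaluating the hash functions and running the test), and
  \<open>build_cost S f\<close> is the work of building the retrieval data structure.\<close>

definition space_usage ::
  "('k set \<Rightarrow> (bool \<Rightarrow> 'k \<Rightarrow> nat) \<Rightarrow> ('k \<Rightarrow> bool) option) \<Rightarrow>
   ('k set \<Rightarrow> ('k \<Rightarrow> bool) \<Rightarrow> bool list) \<Rightarrow>
   'k set \<Rightarrow> (nat \<times> bool \<times> 'k \<Rightarrow> nat) \<Rightarrow> ennreal" where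
  "space_usage test build S \<omega> =
     (if terminates S \<omega> then of_nat (stored_bits (shockhash test build S \<omega>)) else \<infinity>)"

definition construction_time ::
  "('k set \<Rightarrow> (bool \<Rightarrow> 'k \<Rightarrow> nat) \<Rightarrow> ('k \<Rightarrow> bool) option) \<Rightarrow>
   ('k set \<Rightarrow> (bool \<Rightarrow> 'k \<Rightarrow> nat) \<Rightarrow> nat) \<Rightarrow> ('k set \<Rightarrow> ('k \<Rightarrow> bool) \<Rightarrow> nat) \<Rightarrow>
   'k set \<Rightarrow> (nat \<times> bool \<times> 'k \<Rightarrow> nat) \<Rightarrow> ennreal" where
  "construction_time test test_cost build_cost S \<omega> =
     (if terminates S \<omega>
      then of_nat ((\<Sum>s\<le>found_seed S \<omega>. test_cost S (hashes \<omega> s))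
                   + build_cost S (found_choice test S \<omega>))
      else \<infinity>)"

end

theory Submission
  imports Defs "HOL-Real_Asymp.Real_Asymp"
begin

text \<open>Let \<open>p\<close> be the probability that a single seed works, and let \<open>X\<close> be the number of choices
  of one hash value per key that are bijections.  A fixed choice is a bijection with probability
  \<open>n! / n^n\<close>, so \<open>E X = 2^n n! / n^n\<close>, which bounds \<open>p\<close> from above.  For the lower bound, two
  choices that differ in \<open>k\<close> keys are both bijections with probability at most
  \<open>(n! / n^n) (k! / n^k)\<close>, and summing over all pairs gives
  \<open>E (X^2) \<le> 2^n (n! / n^n)^2 (\<Sum>j\<le>n. n^j / j!) \<le> 2^n (n! / n^n)^2 e^n\<close>; hence Cauchy--Schwarz yields
  \<open>p \<ge> (E X)^2 / E (X^2) \<ge> (2 / e)^n\<close> with no loss of a polynomial factor.  The number of seeds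
  tried is geometric with mean \<open>1 / p\<close>.  The expected logarithm of the seed is bounded above by the
  tangent of the logarithm at \<open>1 / p\<close>, and below because all seeds up to \<open>1 / (p n)\<close> fail with
  probability at least \<open>1 - 1 / n\<close>.\<close>

subsection \<open>Pseudoforests and orientations\<close>

definition adj :: "'e set \<Rightarrow> ('e \<Rightarrow> 'v) \<Rightarrow> ('e \<Rightarrow> 'v) \<Rightarrow> ('v \<times> 'v) set" where
  "adj E a b = (\<Union>x\<in>E. {(a x, b x), (b x, a x)})"

lemma adjI: "x \<in> E \<Longrightarrow> (a x, b x) \<in> adj E a b" "x \<in> E \<Longrightarrow> (b x, a x) \<in> adj E a b"
  by (auto simp: adj_def)

lemma adjE:
  assumes "(u, v) \<in> adj E a b"
  obtains x where "x \<in> E" "(a x = u \<and> b x = v) \<or> (b x = u \<and> a x = v)"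
  using assms by (auto simp: adj_def)

lemma sym_adj: "sym (adj E a b)"
  by (auto simp: sym_def adj_def)

lemma adj_mono: "D \<subseteq> E \<Longrightarrow> adj D a b \<subseteq> adj E a b"
  by (auto simp: adj_def)

lemma path_stays:
  assumes "(v, u) \<in> R\<^sup>*" "v \<in> W" "R `` W \<subseteq> W"
  shows "u \<in> W"
  using assms by (induction rule: rtrancl_induct) auto

text \<open>An overfull subset \<open>W\<close> of a component stays overfull when it is grown along a crossing edge, so
  eventually the whole component would be overfull.\<close>

lemma subset_of_component_edges:
  fixes a b :: "'e \<Rightarrow> 'v"
  assumes E: "finite E" and C: "finite C"
    and conn: "\<And>u v. u \<in> C \<Longrightarrow> v \<in> C \<Longrightarrow> (u, v) \<in> (adj E a b)\<^sup>*"
    and closed: "adj E a b `` C \<subseteq> C"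
    and le: "card {x\<in>E. a x \<in> C \<and> b x \<in> C} \<le> card C"
    and W: "W \<subseteq> C" "W \<noteq> {}"
  shows "card {x\<in>E. a x \<in> W \<and> b x \<in> W} \<le> card W"
  using W
proof (induction "card (C - W)" arbitrary: W rule: less_induct)
  case less
  let ?R = "adj E a b"
  have fin: "finite W"
    using less.prems C finite_subset by blast
  show ?case
  proof (cases "W = C")
    case True
    then show ?thesis using le by simp
  next
    case False
    then obtain w u where wu: "w \<in> W" "u \<in> C" "u \<notin> W"
      using less.prems by blast
    then have "(w, u) \<in> ?R\<^sup>*"
      using conn less.prems by blast
    then have "\<not> ?R `` W \<subseteq> W"
      using path_stays[of w u ?R W] wu by blast
    then obtain w' v where "w' \<in> W" "(w', v) \<in> ?R" "v \<notin> W"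
      by blast
    then obtain x where x: "x \<in> E" "v \<notin> W"
      and cross: "(a x \<in> W \<and> b x = v) \<or> (b x \<in> W \<and> a x = v)"
      by (metis adjE)
    have v: "v \<in> C"
      using cross closed less.prems adjI[OF x(1), where a = a and b = b] by blast
    have "card (C - insert v W) < card (C - W)"
      using v x C by (intro psubset_card_mono) auto
    then have "card {y\<in>E. a y \<in> insert v W \<and> b y \<in> insert v W} \<le> card (insert v W)"
      using less.hyps[of "insert v W"] less.prems v by simp
    moreover have "card (insert x {y\<in>E. a y \<in> W \<and> b y \<in> W})
        \<le> card {y\<in>E. a y \<in> insert v W \<and> b y \<in> insert v W}"
      using x cross E by (intro card_mono) auto
    moreover have "card (insert x {y\<in>E. a y \<in> W \<and> b y \<in> W}) = Suc (card {y\<in>E. a y \<in> W \<and> b y \<in> W})"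
      using x cross E by (subst card_insert_disjoint) auto
    ultimately show ?thesis
      using x fin by simp
  qed
qed

text \<open>With \<open>r x\<close> read as the head of edge \<open>x\<close>, this is an
  orientation of in-degree at most one. It is stated for a subset \<open>D\<close> of the edges
  because the construction adds them one by one.\<close>

definition orients :: "'e set \<Rightarrow> ('e \<Rightarrow> 'v) \<Rightarrow> ('e \<Rightarrow> 'v) \<Rightarrow> ('e \<Rightarrow> 'v) \<Rightarrow> bool" where
  "orients D a b r \<longleftrightarrow> inj_on r D \<and> (\<forall>x\<in>D. r x \<in> {a x, b x})"

lemma orients_insert:
  assumes "orients D a b r" "x \<notin> D" "v \<in> {a x, b x}" "v \<notin> r ` D"
  shows "orients (insert x D) a b (r(x := v))"
proof -
  have "inj_on (r(x := v)) D"
    using assms by (intro inj_on_fun_updI) (auto simp: orients_def)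
  then show ?thesis
    using assms by (auto simp: orients_def inj_on_insert)
qed

text \<open>An augmenting path argument: starting from the free vertex \<open>u\<close>, edges are
  redirected one by one along the path, which moves the free place back to \<open>v\<close>.\<close>

lemma free_vertex_along_path:
  assumes "(v, u) \<in> (adj D a b)\<^sup>*"
    and "orients D a b r" and "u \<notin> r ` D"
  shows "\<exists>r'. orients D a b r' \<and> v \<notin> r' ` D"
  using assms
proof (induction rule: converse_rtrancl_induct)
  case base
  then show ?case by blast
next
  case (step v w)
  then obtain r' where r': "orients D a b r'" "w \<notin> r' ` D"
    by blast
  obtain y where y: "y \<in> D" "(a y = v \<and> b y = w) \<or> (b y = v \<and> a y = w)"
    using step.hyps by (auto elim: adjE)
  show ?case
  proof (cases "v = w")
    case True
    then show ?thesis using r' by blast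
  next
    case False
    \<comment> \<open>Since \<open>w\<close> is free, \<open>y\<close> must point at
      \<open>v\<close>. By injectivity no other edge does, so redirecting \<open>y\<close> to
      \<open>w\<close> frees \<open>v\<close>.\<close>
    have "r' y \<in> {a y, b y}" "r' y \<noteq> w"
      using r' y(1) unfolding orients_def by auto
    then have rv: "r' y = v"
      using y(2) by auto
    have inj: "inj_on r' D" using r'(1) by (simp add: orients_def)
    have "inj_on (r'(y := w)) D"
      by (rule inj_on_fun_updI[OF inj r'(2)])
    moreover have "w \<in> {a y, b y}" using y(2) by blast
    then have "\<forall>x\<in>D. (r'(y := w)) x \<in> {a x, b x}"
      using r'(1) by (simp add: orients_def)
    ultimately have "orients D a b (r'(y := w))"
      unfolding orients_def by blast
    moreover have "v \<notin> (r'(y := w)) ` D"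
    proof
      assume "v \<in> (r'(y := w)) ` D"
      then obtain z where z: "z \<in> D" "v = (r'(y := w)) z" by (rule imageE)
      have "z \<noteq> y" using z(2) False by (cases "z = y") simp_all
      then have "r' z = r' y" using z(2) rv by simp
      then show False using inj_onD[OF inj] z(1) y(1) \<open>z \<noteq> y\<close> by blast
    qed
    ultimately show ?thesis by blast
  qed
qed

text \<open>Edges are oriented one at a time.  If no free vertex can be reached from the new edge, the
  reachable vertices together with their edges violate the edge bound.\<close>

lemma orientation_exists:
  fixes a b :: "'e \<Rightarrow> 'v"
  assumes pf: "pseudoforest V E a b" and fin: "finite E" "finite V"
    and ends: "\<And>x. x \<in> E \<Longrightarrow> a x \<in> V \<and> b x \<in> V"
  shows "\<exists>r. orients E a b r"
proof -
  have "\<exists>r. orients D a b r" if "finite D" "D \<subseteq> E" for D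
    using that
  proof (induction rule: finite_induct)
    case empty
    then show ?case by (simp add: orients_def)
  next
    case (insert x D)
    then obtain r where r: "orients D a b r" by blast
    let ?W = "(adj D a b)\<^sup>* `` {a x, b x}"
    show ?case
    proof (cases "?W \<subseteq> r ` D")
      case False
      then obtain v u where "v \<in> {a x, b x}" "(v, u) \<in> (adj D a b)\<^sup>*" "u \<notin> r ` D"
        by blast
      then obtain r' where r': "orients D a b r'" "v \<notin> r' ` D"
        using free_vertex_along_path[OF _ r] by blast
      have "orients (insert x D) a b (r'(x := v))"
        using orients_insert r' \<open>v \<in> {a x, b x}\<close> \<open>x \<notin> D\<close> by metis
      then show ?thesis by blast
    next
      case True
      define W where "W = (adj D a b)\<^sup>* `` {a x, b x}"
      have Wr: "W \<subseteq> r ` D" using True by (simp only: W_def)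
      \<comment> \<open>The hypothesis speaks only of whole components of the full graph, so
        \<open>W\<close> is placed inside its component with respect to \<open>E\<close> before
        \<open>subset_of_component_edges\<close> is applied.\<close>
      define C where "C = (adj E a b)\<^sup>* `` {a x}"
      have xE: "x \<in> E" and DE: "D \<subseteq> E" using insert.prems by auto
      have comp: "C \<in> components V E a b"
        unfolding C_def components_def adj_def[symmetric] using ends xE by (intro quotientI) auto
      have C_closed: "adj E a b `` C \<subseteq> C"
      proof
        fix v assume "v \<in> adj E a b `` C"
        then obtain u where "u \<in> C" "(u, v) \<in> adj E a b" by blast
        then show "v \<in> C"
          unfolding C_def by (metis Image_singleton_iff rtrancl.rtrancl_into_rtrancl)
      qed
      have CV: "C \<subseteq> V"
      proof
        fix u assume "u \<in> C"
        then have "(a x, u) \<in> (adj E a b)\<^sup>*" by (simp add: C_def)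
        then show "u \<in> V"
          by (rule path_stays) (use ends xE in \<open>auto elim!: adjE\<close>)
      qed
      have finC: "finite C" using CV fin finite_subset by blast
      have "sym (adj E a b)" by (rule sym_adj)
      then have symm: "sym ((adj E a b)\<^sup>*)" by (rule sym_rtrancl)
      have conn: "(u, v) \<in> (adj E a b)\<^sup>*" if "u \<in> C" "v \<in> C" for u v
      proof -
        have "(a x, u) \<in> (adj E a b)\<^sup>*" "(a x, v) \<in> (adj E a b)\<^sup>*"
          using that by (simp_all add: C_def)
        then show ?thesis using symD[OF symm] rtrancl_trans[of u "a x"] by metis
      qed
      have le: "card {y\<in>E. a y \<in> C \<and> b y \<in> C} \<le> card C"
        using pf comp unfolding pseudoforest_def by blast
      have WC: "W \<subseteq> C"
      proof
        fix u assume "u \<in> W"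
        then obtain v where v: "v \<in> {a x, b x}" "(v, u) \<in> (adj D a b)\<^sup>*"
          unfolding W_def by blast
        have "(v, u) \<in> (adj E a b)\<^sup>*"
          using v(2) rtrancl_mono[of "adj D a b" "adj E a b"] adj_mono[OF DE] by blast
        moreover have "(a x, v) \<in> (adj E a b)\<^sup>*"
          using v(1) xE adjI(1)[OF xE, of a b] by auto
        ultimately have "(a x, u) \<in> (adj E a b)\<^sup>*" by (metis rtrancl_trans)
        then show "u \<in> C" by (simp add: C_def)
      qed
      have sparse: "card {y\<in>E. a y \<in> W \<and> b y \<in> W} \<le> card W"
        by (rule subset_of_component_edges[OF fin(1) finC conn C_closed le WC]) (auto simp: W_def)
      \<comment> \<open>Every vertex of \<open>W\<close> is the head of exactly one edge of
        \<open>D\<close>, so \<open>?F\<close> has as many edges as \<open>W\<close> has vertices.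
        As \<open>W\<close> is closed under \<open>D\<close>-adjacency, both ends of these edges lie
        in \<open>W\<close>, and \<open>x\<close> is one edge too many.\<close>
      let ?F = "{y\<in>D. r y \<in> W}"
      have "W = r ` ?F" using Wr by blast
      moreover have "inj_on r ?F" using r unfolding orients_def inj_on_def by auto
      ultimately have cardF: "card W = card ?F" by (metis card_image)
      have step: "v \<in> W" if "u \<in> W" "(u, v) \<in> adj D a b" for u v
        using that unfolding W_def by (meson Image_iff rtrancl.rtrancl_into_rtrancl)
      have sub: "insert x ?F \<subseteq> {y\<in>E. a y \<in> W \<and> b y \<in> W}"
      proof
        fix y assume "y \<in> insert x ?F"
        then consider "y = x" | "y \<in> D" "r y \<in> W" by blast
        then show "y \<in> {y\<in>E. a y \<in> W \<and> b y \<in> W}"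
        proof cases
          case 1
          then show ?thesis using xE unfolding W_def by auto
        next
          case 2
          then have "r y = a y \<or> r y = b y" "(a y, b y) \<in> adj D a b" "(b y, a y) \<in> adj D a b"
            using r adjI[of y D, where a = a and b = b] unfolding orients_def by auto
          then show ?thesis using 2 DE step[of "a y" "b y"] step[of "b y" "a y"] by auto
        qed
      qed
      have "card (insert x ?F) \<le> card {y\<in>E. a y \<in> W \<and> b y \<in> W}"
        by (rule card_mono[OF _ sub]) (use fin in simp)
      moreover have "card (insert x ?F) = Suc (card ?F)"
        using insert.hyps by (subst card_insert_disjoint) auto
      ultimately show ?thesis using sparse cardF by simp
    qed
  qed
  then show ?thesis using fin by blast
qed

text \<open>A perfect choice maps the edges inside a component injectively to their chosen ends in
  that component. Conversely, an orientation injects \<open>S\<close> into a set of the same size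
  and is therefore bijective.\<close>

theorem perfect_choice_iff_pseudoforest:
  assumes S: "finite S" and h: "hash_pair S h"
  shows "(\<exists>f. perfect_choice S h f) \<longleftrightarrow> pseudoforest {1..card S} S (h False) (h True)"
proof
  have ends: "h i x \<in> {1..card S}" if "x \<in> S" for i x
    using h that unfolding hash_pair_def by blast
  {
    assume "\<exists>f. perfect_choice S h f"
    then obtain f where f: "bij_betw (\<lambda>x. h (f x) x) S {1..card S}"
      unfolding perfect_choice_def by blast
    show "pseudoforest {1..card S} S (h False) (h True)"
      unfolding pseudoforest_def
    proof
      fix C assume "C \<in> components {1..card S} S (h False) (h True)"
      then obtain v where v: "v \<in> {1..card S}"
        and C: "C = (adj S (h False) (h True))\<^sup>* `` {v}"
        unfolding components_def adj_def by (auto elim!: quotientE)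
      have "C \<subseteq> {1..card S}"
      proof
        fix u assume "u \<in> C"
        then have "(v, u) \<in> (adj S (h False) (h True))\<^sup>*"
          using C by simp
        then show "u \<in> {1..card S}"
          by (rule path_stays) (use v ends in \<open>auto elim!: adjE\<close>)
      qed
      then have finC: "finite C" using finite_subset by blast
      show "card {x \<in> S. h False x \<in> C \<and> h True x \<in> C} \<le> card C"
      proof (rule card_inj_on_le[OF _ _ finC])
        show "inj_on (\<lambda>x. h (f x) x) {x \<in> S. h False x \<in> C \<and> h True x \<in> C}"
          using bij_betw_imp_inj_on[OF f] by (rule inj_on_subset) auto
        show "(\<lambda>x. h (f x) x) ` {x \<in> S. h False x \<in> C \<and> h True x \<in> C} \<subseteq> C"
        proof clarify
          fix x assume "h False x \<in> C" "h True x \<in> C"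
          then show "h (f x) x \<in> C" by (cases "f x") auto
        qed
      qed
    qed
  }
  {
    assume "pseudoforest {1..card S} S (h False) (h True)"
    then obtain r where r: "orients S (h False) (h True) r"
      using orientation_exists[of "{1..card S}" S "h False" "h True"] S ends by blast
    \<comment> \<open>If the two hash values of \<open>x\<close> coincide, either bit would do; this
      definition then takes \<open>True\<close>.\<close>
    define f where "f x \<longleftrightarrow> r x = h True x" for x
    have hf: "h (f x) x = r x" if "x \<in> S" for x
      using r that unfolding orients_def f_def by (cases "r x = h True x") auto
    have inj: "inj_on (\<lambda>x. h (f x) x) S"
      using r hf unfolding orients_def inj_on_def by simp
    have "(\<lambda>x. h (f x) x) ` S \<subseteq> {1..card S}" using ends by blast
    then have "(\<lambda>x. h (f x) x) ` S = {1..card S}"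
      using inj by (intro card_subset_eq) (auto simp: card_image)
    then show "\<exists>f. perfect_choice S h f"
      using inj unfolding perfect_choice_def bij_betw_def by blast
  }
qed

subsection \<open>The probability that a seed works\<close>

text \<open>The functions are extensional, so this set is finite and each behaviour on
  \<open>S\<close> is counted once.\<close>

definition hash_pairs :: "'k set \<Rightarrow> (bool \<Rightarrow> 'k \<Rightarrow> nat) set" where
  "hash_pairs S = {h. \<forall>i. h i \<in> S \<rightarrow>\<^sub>E {1..card S}}"

definition good_pairs :: "'k set \<Rightarrow> (bool \<Rightarrow> 'k \<Rightarrow> nat) set" where
  "good_pairs S = {h \<in> hash_pairs S. \<exists>f. perfect_choice S h f}"

text \<open>The success probability enters as a ratio of counts; \<open>prob_all_fail\<close>
  connects it with \<open>hash_space\<close>.\<close>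

definition good_prob :: "'k set \<Rightarrow> real" where
  "good_prob S = card (good_pairs S) / real (card S) ^ (2 * card S)"

lemma hash_pairs_PiE: "hash_pairs S = (UNIV :: bool set) \<rightarrow>\<^sub>E (S \<rightarrow>\<^sub>E {1..card S})"
  by (auto simp: hash_pairs_def PiE_def)

lemma finite_hash_pairs: "finite S \<Longrightarrow> finite (hash_pairs S)"
  unfolding hash_pairs_PiE by (intro finite_PiE) auto

lemma card_hash_pairs: "finite S \<Longrightarrow> card (hash_pairs S) = card S ^ (2 * card S)"
  unfolding hash_pairs_PiE by (simp add: card_funcsetE power_mult[symmetric] mult.commute)

lemma hash_pairsD: "h \<in> hash_pairs S \<Longrightarrow> hash_pair S h"
  by (auto simp: hash_pairs_def hash_pair_def PiE_def)

text \<open>Swapping the two hash values on \<open>A\<close> reduces a pair of choices \<open>A\<close>, \<open>B\<close> to the pair \<open>{}\<close>,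
  \<open>sym_diff A B\<close>.\<close>

definition flip :: "'k set \<Rightarrow> (bool \<Rightarrow> 'k \<Rightarrow> nat) \<Rightarrow> bool \<Rightarrow> 'k \<Rightarrow> nat" where
  "flip A h i x = h (i \<noteq> (x \<in> A)) x"

lemma flip_flip [simp]: "flip A (flip A h) = h"
proof (intro ext)
  fix i x show "flip A (flip A h) i x = h i x"
    by (cases i; cases "x \<in> A") (simp_all add: flip_def)
qed

lemma flip_in_hash_pairs: "h \<in> hash_pairs S \<Longrightarrow> flip A h \<in> hash_pairs S"
  by (auto simp: flip_def hash_pairs_def PiE_iff extensional_def)

text \<open>Only the values of a choice on \<open>S\<close> matter, so the \<open>2 ^ card S\<close>
  subsets of \<open>S\<close> represent all choices.\<close>

abbreviation perfect_on :: "'k set \<Rightarrow> (bool \<Rightarrow> 'k \<Rightarrow> nat) \<Rightarrow> 'k set \<Rightarrow> bool" where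
  "perfect_on S h A \<equiv> perfect_choice S h (\<lambda>x. x \<in> A)"

lemma perfect_on_flip: "perfect_on S (flip A h) B \<longleftrightarrow> perfect_on S h (sym_diff A B)"
proof -
  have "(x \<in> B) \<noteq> (x \<in> A) \<longleftrightarrow> x \<in> sym_diff A B" for x
    by blast
  then show ?thesis
    unfolding perfect_choice_def flip_def by simp
qed

lemma card_both_perfect:
  "card {h \<in> hash_pairs S. perfect_on S h A \<and> perfect_on S h B}
     = card {h \<in> hash_pairs S. perfect_on S h {} \<and> perfect_on S h (sym_diff A B)}"
proof (rule bij_betw_same_card)
  have e: "sym_diff A A = {}" "sym_diff A {} = A" "sym_diff A (sym_diff A B) = B"
    by blast+
  show "bij_betw (flip A) {h \<in> hash_pairs S. perfect_on S h A \<and> perfect_on S h B}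
      {h \<in> hash_pairs S. perfect_on S h {} \<and> perfect_on S h (sym_diff A B)}"
    by (rule bij_betw_byWitness[where f' = "flip A"])
      (use e in \<open>auto simp only: Un_empty_left perfect_on_flip flip_flip flip_in_hash_pairs\<close>)
qed

text \<open>By flipping, \<open>A\<close> may be taken to be empty. Then \<open>h False\<close> is
  one of \<open>n!\<close> bijections and \<open>h True\<close> is arbitrary.\<close>

lemma card_perfect_on:
  assumes "finite S"
  shows "card {h \<in> hash_pairs S. perfect_on S h A} = fact (card S) * card S ^ card S"
proof -
  define V where "V = {1..card S}"
  have V: "finite V" "card V = card S" by (simp_all add: V_def)
  let ?B = "{g \<in> S \<rightarrow>\<^sub>E V. inj_on g S}"
  have "card {h \<in> hash_pairs S. perfect_on S h A} = card {h \<in> hash_pairs S. perfect_on S h {}}"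
    using card_both_perfect[of S A A] by simp
  also have "\<dots> = card (?B \<times> (S \<rightarrow>\<^sub>E V))"
  proof (rule bij_betw_same_card)
    have bij: "bij_betw g S V \<longleftrightarrow> inj_on g S" if "g \<in> S \<rightarrow>\<^sub>E V" for g
    proof
      assume "inj_on g S"
      moreover have "g ` S \<subseteq> V" using that by auto
      ultimately show "bij_betw g S V"
        unfolding bij_betw_def using V by (simp add: card_image card_subset_eq)
    qed (simp add: bij_betw_def)
    have "{h \<in> hash_pairs S. perfect_on S h {}} = {h. (\<forall>i. h i \<in> S \<rightarrow>\<^sub>E V) \<and> inj_on (h False) S}"
      unfolding hash_pairs_def perfect_choice_def V_def[symmetric] using bij by auto
    then show "bij_betw (\<lambda>h. (h False, h True)) {h \<in> hash_pairs S. perfect_on S h {}} (?B \<times> (S \<rightarrow>\<^sub>E V))"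
      by (simp only:, intro bij_betw_byWitness[where f' = "\<lambda>(g, g') i. if i then g' else g"])
        (auto intro!: ext)
  qed
  also have "\<dots> = fact (card S) * card S ^ card S"
    using card_inj_on_subset_funcset[of S V S] assms V
    by (simp add: card_cartesian_product card_funcsetE fact_prod_rev)
  finally show ?thesis .
qed

text \<open>Given the bijection \<open>g = h False\<close>, the function \<open>h True\<close> has to map \<open>D\<close> bijectively onto \<open>g ` D\<close> and is
  arbitrary outside \<open>D\<close>.\<close>

lemma card_both_perfect_le:
  assumes S: "finite S" and D: "D \<subseteq> S"
  shows "card {h \<in> hash_pairs S. perfect_on S h {} \<and> perfect_on S h D}
      \<le> fact (card S) * (fact (card D) * card S ^ (card S - card D))"
proof -
  let ?V = "{1..card S}"
  let ?B = "{g \<in> S \<rightarrow>\<^sub>E ?V. inj_on g S}"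
  let ?T = "\<lambda>g. {g' \<in> D \<rightarrow>\<^sub>E g ` D. inj_on g' D} \<times> ((S - D) \<rightarrow>\<^sub>E ?V)"
  let ?F = "\<lambda>h. (h False, restrict (h True) D, restrict (h True) (S - D))"
  let ?L = "{h \<in> hash_pairs S. perfect_on S h {} \<and> perfect_on S h D}"
  have finD: "finite D" using S D finite_subset by blast
  have finB: "finite ?B" using S by (auto intro!: finite_PiE)
  have finT: "finite (?T g)" for g
  proof (rule finite_cartesian_product)
    have "finite (D \<rightarrow>\<^sub>E g ` D)" by (intro finite_PiE finD finite_imageI)
    then show "finite {g' \<in> D \<rightarrow>\<^sub>E g ` D. inj_on g' D}" by simp
    show "finite ((S - D) \<rightarrow>\<^sub>E ?V)" using S by (intro finite_PiE) auto
  qed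
  have card_T: "card (?T g) = fact (card D) * card S ^ (card S - card D)" if "g \<in> ?B" for g
  proof -
    have "card (g ` D) = card D"
      using that D by (intro card_image) (auto intro: inj_on_subset)
    then show ?thesis
      using card_inj_on_subset_funcset[of D "g ` D" D] finD S D
      by (simp add: card_cartesian_product card_funcsetE fact_prod_rev card_Diff_subset)
  qed
  have "card ?L \<le> card (Sigma ?B ?T)"
  proof (rule card_inj_on_le)
    show "inj_on ?F ?L"
    proof (rule inj_onI)
      fix h k assume h: "h \<in> ?L" and k: "k \<in> ?L" and eq: "?F h = ?F k"
      have "h True x = k True x" for x
      proof -
        consider "x \<in> D" | "x \<in> S - D" | "x \<notin> S" by blast
        then show ?thesis
        proof cases
          case 1
          then show ?thesis using eq by (metis Pair_inject restrict_apply')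
        next
          case 2
          then show ?thesis using eq by (metis Pair_inject restrict_apply')
        next
          case 3
          have "h True \<in> S \<rightarrow>\<^sub>E ?V" "k True \<in> S \<rightarrow>\<^sub>E ?V"
            using h k by (simp_all add: hash_pairs_def)
          then show ?thesis using 3 PiE_arb by metis
        qed
      qed
      moreover have "h False x = k False x" for x
        using eq by simp
      ultimately have "h i x = k i x" for i x
        by (cases i) simp_all
      then show "h = k" by blast
    qed
    show "?F ` ?L \<subseteq> Sigma ?B ?T"
    proof
      fix z assume "z \<in> ?F ` ?L"
      then obtain h where h: "h \<in> ?L" "z = ?F h" by blast
      have f: "h False \<in> S \<rightarrow>\<^sub>E ?V" and t: "h True \<in> S \<rightarrow>\<^sub>E ?V"
        using h(1) by (simp_all add: hash_pairs_def)
      have b0: "bij_betw (h False) S ?V"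
        using h(1) by (simp add: perfect_choice_def)
      have bD: "bij_betw (\<lambda>x. h (x \<in> D) x) S ?V"
        using h(1) by (simp add: perfect_choice_def)
      have injD: "inj_on (h True) D"
        using inj_on_subset[OF bij_betw_imp_inj_on[OF bD] D] by (simp add: inj_on_def)
      have "h True x \<in> h False ` D" if x: "x \<in> D" for x
      proof -
        have "h True x \<in> ?V" using t x D by auto
        then obtain y where y: "y \<in> S" "h True x = h False y"
          using b0 by (metis bij_betw_imp_surj_on imageE)
        \<comment> \<open>If \<open>y\<close> were outside \<open>D\<close>, the second choice would
          send both \<open>x\<close> and \<open>y\<close> to the value
          \<open>h True x\<close>.\<close>
        have "y \<in> D"
        proof (rule ccontr)
          assume "y \<notin> D"
          then have "h (x \<in> D) x = h (y \<in> D) y" using x y by simp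
          then have "x = y" using bD x y D unfolding bij_betw_def inj_on_def by blast
          then show False using x \<open>y \<notin> D\<close> by simp
        qed
        then show ?thesis using y by blast
      qed
      then have "restrict (h True) D \<in> D \<rightarrow>\<^sub>E h False ` D"
        by auto
      moreover have "inj_on (restrict (h True) D) D"
        using injD by (simp add: inj_on_def)
      moreover have "restrict (h True) (S - D) \<in> (S - D) \<rightarrow>\<^sub>E ?V"
        using t by auto
      ultimately show "z \<in> Sigma ?B ?T"
        using f b0 h(2) by (simp add: bij_betw_def)
    qed
    show "finite (Sigma ?B ?T)"
      by (rule finite_SigmaI[OF finB finT])
  qed
  also have "\<dots> = (\<Sum>g\<in>?B. card (?T g))"
    using finB finT by (intro card_SigmaI) blast+
  also have "\<dots> = card ?B * (fact (card D) * card S ^ (card S - card D))"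
    using card_T by simp
  also have "card ?B = fact (card S)"
    using card_inj_on_subset_funcset[of S ?V S] S by (simp add: fact_prod_rev)
  finally show ?thesis .
qed

section \<open>First and second moment of the number of perfect choices\<close>

lemma sum_Pow_card:
  fixes g :: "nat \<Rightarrow> real"
  assumes "finite S"
  shows "(\<Sum>D\<in>Pow S. g (card D)) = (\<Sum>k\<le>card S. real (card S choose k) * g k)"
proof -
  have "(\<Sum>D\<in>Pow S. g (card D)) = (\<Sum>k\<le>card S. \<Sum>D | D \<in> Pow S \<and> card D = k. g (card D))"
    using assms by (intro sum.group[symmetric]) (auto intro: card_mono)
  also have "\<dots> = (\<Sum>k\<le>card S. real (card S choose k) * g k)"
    using n_subsets[OF assms] by (intro sum.cong) simp_all
  finally show ?thesis .
qed

lemma exp_partial_sum_le: "(\<Sum>j\<le>n. x ^ j / fact j) \<le> exp (x :: real)" if "x \<ge> 0"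
proof -
  have "(\<Sum>j\<le>n. x ^ j / fact j) \<le> (\<Sum>j. x ^ j / fact j)"
    using that summable_exp[of x]
    by (intro sum_le_suminf) (auto simp: divide_inverse mult.commute)
  also have "\<dots> = exp x"
    by (simp add: exp_def divide_inverse mult.commute scaleR_conv_of_real)
  finally show ?thesis .
qed

text \<open>Since \<open>(n choose k) * k! = n! / (n - k)!\<close>, substituting
  \<open>j = n - k\<close> leaves a partial sum of the series of \<open>exp n\<close>. This is the
  source of the factor \<open>exp n\<close> in the second moment.\<close>

lemma sum_binomial_fact_le:
  "(\<Sum>k\<le>n. real (n choose k) * (fact k * real n ^ (n - k))) \<le> fact n * exp (real n)"
proof -
  have "(\<Sum>k\<le>n. real (n choose k) * (fact k * real n ^ (n - k)))
      = (\<Sum>k\<le>n. fact n * (real n ^ (n - k) / fact (n - k)))"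
    by (intro sum.cong) (auto simp: binomial_fact)
  also have "\<dots> = (\<Sum>j\<le>n. fact n * (real n ^ j / fact j))"
    by (rule sum.reindex_bij_witness[of _ "\<lambda>j. n - j" "\<lambda>j. n - j"]) auto
  also have "\<dots> = fact n * (\<Sum>j\<le>n. real n ^ j / fact j)"
    by (simp add: sum_distrib_left)
  also have "\<dots> \<le> fact n * exp (real n)"
    by (intro mult_left_mono exp_partial_sum_le) auto
  finally show ?thesis .
qed

text \<open>The random variable \<open>X\<close> of the overview, real-valued so that
  Cauchy--Schwarz applies directly.\<close>

definition num_choices :: "'k set \<Rightarrow> (bool \<Rightarrow> 'k \<Rightarrow> nat) \<Rightarrow> real" where
  "num_choices S h = (\<Sum>A\<in>Pow S. of_bool (perfect_on S h A))"

lemma num_choices_pos: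
  assumes "finite S" "perfect_choice S h f"
  shows "num_choices S h \<ge> 1"
proof -
  have "perfect_on S h {x \<in> S. f x}"
    using assms(2) unfolding perfect_choice_def by (auto cong: bij_betw_cong)
  then have "(1::real) = (\<Sum>A\<in>{{x \<in> S. f x}}. of_bool (perfect_on S h A))"
    by simp
  also have "\<dots> \<le> num_choices S h"
    unfolding num_choices_def using assms(1) by (intro sum_mono2) auto
  finally show ?thesis .
qed

lemma sum_num_choices:
  assumes "finite S"
  shows "(\<Sum>h\<in>hash_pairs S. num_choices S h) = 2 ^ card S * (fact (card S) * real (card S) ^ card S)"
proof -
  have "(\<Sum>h\<in>hash_pairs S. num_choices S h)
      = (\<Sum>A\<in>Pow S. \<Sum>h\<in>hash_pairs S. of_bool (perfect_on S h A))"
    unfolding num_choices_def by (rule sum.swap)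
  also have "\<dots> = (\<Sum>A\<in>Pow S. real (card {h \<in> hash_pairs S. perfect_on S h A}))"
    using finite_hash_pairs[OF assms] by (simp add: sum_of_bool_eq Int_def)
  also have "\<dots> = 2 ^ card S * (fact (card S) * real (card S) ^ card S)"
    using assms by (simp add: card_perfect_on card_Pow)
  finally show ?thesis .
qed

text \<open>The square expands into a sum over pairs \<open>A\<close>, \<open>B\<close>, and the
  count for a pair depends only on \<open>sym_diff A B\<close>. For fixed \<open>A\<close> this
  difference runs once through \<open>Pow S\<close>, so the choice of \<open>A\<close> contributes
  just a factor \<open>2 ^ n\<close>. The sums are not normalised by the number of hash
  pairs.\<close>

lemma sum_num_choices_squared:
  assumes "finite S"
  shows "(\<Sum>h\<in>hash_pairs S. (num_choices S h)\<^sup>2) \<le> 2 ^ card S * ((fact (card S))\<^sup>2 * exp (real (card S)))"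
proof -
  let ?n = "card S"
  let ?c = "\<lambda>D. real (card {h \<in> hash_pairs S. perfect_on S h {} \<and> perfect_on S h D})"
  have "(\<Sum>h\<in>hash_pairs S. (num_choices S h)\<^sup>2)
      = (\<Sum>h\<in>hash_pairs S. \<Sum>A\<in>Pow S. \<Sum>B\<in>Pow S. of_bool (perfect_on S h A \<and> perfect_on S h B))"
    unfolding num_choices_def power2_eq_square sum_product
    by (intro sum.cong refl) (simp add: of_bool_conj)
  also have "\<dots> = (\<Sum>A\<in>Pow S. \<Sum>B\<in>Pow S. \<Sum>h\<in>hash_pairs S. of_bool (perfect_on S h A \<and> perfect_on S h B))"
    by (subst sum.swap) (intro sum.cong refl sum.swap)
  also have "\<dots> = (\<Sum>A\<in>Pow S. \<Sum>B\<in>Pow S.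
      real (card {h \<in> hash_pairs S. perfect_on S h A \<and> perfect_on S h B}))"
    using finite_hash_pairs[OF assms] by (simp add: sum_of_bool_eq Int_def)
  also have "\<dots> = (\<Sum>A\<in>Pow S. \<Sum>B\<in>Pow S. ?c (sym_diff A B))"
    by (intro sum.cong refl arg_cong[of _ _ real] card_both_perfect)
  also have "\<dots> = (\<Sum>A\<in>Pow S. \<Sum>D\<in>Pow S. ?c D)"
  proof (rule sum.cong[OF refl])
    fix A assume "A \<in> Pow S"
    then show "(\<Sum>B\<in>Pow S. ?c (sym_diff A B)) = (\<Sum>D\<in>Pow S. ?c D)"
      by (intro sum.reindex_bij_witness[where i = "sym_diff A" and j = "sym_diff A"]) auto
  qed
  also have "\<dots> = 2 ^ ?n * (\<Sum>D\<in>Pow S. ?c D)"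
    using assms by (simp add: card_Pow)
  also have "(\<Sum>D\<in>Pow S. ?c D) \<le> (\<Sum>D\<in>Pow S. fact ?n * (fact (card D) * real ?n ^ (?n - card D)))"
  proof (rule sum_mono)
    fix D assume "D \<in> Pow S"
    then show "?c D \<le> fact ?n * (fact (card D) * real ?n ^ (?n - card D))"
      using of_nat_mono[OF card_both_perfect_le[OF assms, of D], where 'a = real] by simp
  qed
  also have "\<dots> = fact ?n * (\<Sum>k\<le>?n. real (?n choose k) * (fact k * real ?n ^ (?n - k)))"
    using sum_Pow_card[OF assms, of "\<lambda>k. fact k * real ?n ^ (?n - k)"]
    by (simp add: sum_distrib_left[symmetric])
  also have "\<dots> \<le> fact ?n * (fact ?n * exp (real ?n))"
    by (intro mult_left_mono sum_binomial_fact_le) auto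
  finally show ?thesis
    by (simp add: power2_eq_square mult.assoc)
qed

text \<open>A weak Stirling bound. The induction step amounts to
  \<open>e \<le> (1 + 1/n) ^ (n + 1)\<close>, which follows from \<open>ln z \<le> z - 1\<close> at
  \<open>z = n / (n + 1)\<close>.\<close>

lemma fact_upper_bound:
  assumes "n \<ge> 1"
  shows "fact n * exp (real n) \<le> exp 1 * real n * real n ^ n"
  using assms
proof (induction n rule: dec_induct)
  case base
  then show ?case by simp
next
  case (step n)
  have "ln (real n / real (Suc n)) \<le> real n / real (Suc n) - 1"
    using step by (intro ln_le_minus_one) simp
  then have "1 / real (Suc n) \<le> ln (real (Suc n) / real n)"
    using step by (simp add: ln_div field_simps)
  then have "1 \<le> real (Suc n) * ln (real (Suc n) / real n)"
    by (simp add: field_simps)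
  then have "1 \<le> ln ((real (Suc n) / real n) ^ Suc n)"
    using step ln_realpow[of "real (Suc n) / real n" "Suc n"] by simp
  then have "exp 1 \<le> (real (Suc n) / real n) ^ Suc n"
    using step by (subst (asm) ln_ge_iff) (auto intro!: zero_less_power divide_pos_pos simp del: power_Suc)
  then have key: "exp 1 * real n ^ Suc n \<le> real (Suc n) ^ Suc n"
    using step by (simp add: power_divide field_simps)
  have "fact (Suc n) * exp (real (Suc n)) = real (Suc n) * exp 1 * (fact n * exp (real n))"
    by (simp add: exp_add)
  also have "\<dots> \<le> real (Suc n) * exp 1 * (exp 1 * real n * real n ^ n)"
    using step.IH by (intro mult_left_mono) auto
  also have "\<dots> = exp 1 * real (Suc n) * (exp 1 * real n ^ Suc n)"
    by simp
  also have "\<dots> \<le> exp 1 * real (Suc n) * real (Suc n) ^ Suc n"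
    using key by (intro mult_left_mono) auto
  finally show ?case .
qed

text \<open>The second moment method: \<open>num_choices\<close> vanishes outside
  \<open>good_pairs\<close>, so Cauchy--Schwarz with the constant 1 on \<open>good_pairs\<close>
  bounds their number from below.\<close>

lemma good_prob_lower:
  assumes S: "finite S" "S \<noteq> {}"
  shows "(2 / exp 1) ^ card S \<le> good_prob S"
proof -
  let ?n = "card S" and ?X = "num_choices S"
  let ?G = "real (card (good_pairs S))"
  have n: "?n > 0" using S by (simp add: card_gt_0_iff)
  have square_power: "real ?n ^ (2 * ?n) = real ?n ^ ?n * real ?n ^ ?n"
    by (simp add: mult_2 power_add)
  have fin: "finite (hash_pairs S)" by (rule finite_hash_pairs[OF S(1)])
  have X0: "?X h = 0" if "h \<in> hash_pairs S - good_pairs S" for h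
    using that unfolding good_pairs_def num_choices_def by (intro sum.neutral) auto
  have "(2 ^ ?n * (fact ?n * real ?n ^ ?n))\<^sup>2 = (\<Sum>h\<in>good_pairs S. 1 * ?X h)\<^sup>2"
    unfolding sum_num_choices[OF S(1), symmetric] using fin X0
    by (simp add: sum.mono_neutral_right[of "hash_pairs S" "good_pairs S"] good_pairs_def)
  also have "\<dots> \<le> (\<Sum>h\<in>good_pairs S. 1\<^sup>2) * (\<Sum>h\<in>good_pairs S. (?X h)\<^sup>2)"
    by (rule Cauchy_Schwarz_ineq_sum)
  also have "\<dots> \<le> ?G * (\<Sum>h\<in>hash_pairs S. (?X h)\<^sup>2)"
    using fin by (simp, intro mult_left_mono sum_mono2) (auto simp: good_pairs_def)
  also have "\<dots> \<le> ?G * (2 ^ ?n * ((fact ?n)\<^sup>2 * exp (real ?n)))"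
    by (intro mult_left_mono sum_num_choices_squared S) auto
  \<comment> \<open>Both sides are written with a common positive factor, which is cancelled
    next.\<close>
  finally have "2 ^ ?n * (fact ?n)\<^sup>2 * (2 ^ ?n * real ?n ^ (2 * ?n))
      \<le> 2 ^ ?n * (fact ?n)\<^sup>2 * (?G * exp (real ?n))"
    unfolding square_power by (simp add: power2_eq_square mult_ac)
  then have "2 ^ ?n * real ?n ^ (2 * ?n) \<le> ?G * exp (real ?n)"
    by (subst (asm) mult_le_cancel_left_pos) auto
  then show ?thesis
    unfolding good_prob_def square_power using n by (simp add: power_divide exp_of_nat_mult[symmetric] field_simps)
qed

text \<open>The first moment method: every good pair admits at least one perfect choice. The extra
  factor \<open>e * n\<close> comes from \<open>fact_upper_bound\<close> and costs only
  logarithmically many bits later.\<close>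

lemma good_prob_upper:
  assumes S: "finite S" "S \<noteq> {}"
  shows "good_prob S \<le> exp 1 * real (card S) * (2 / exp 1) ^ card S"
proof -
  let ?n = "card S"
  have n: "?n > 0" using S by (simp add: card_gt_0_iff)
  have square_power: "real ?n ^ (2 * ?n) = real ?n ^ ?n * real ?n ^ ?n"
    by (simp add: mult_2 power_add)
  have fin: "finite (hash_pairs S)" by (rule finite_hash_pairs[OF S(1)])
  have "real (card (good_pairs S)) = (\<Sum>h\<in>good_pairs S. 1)"
    by simp
  also have "\<dots> \<le> (\<Sum>h\<in>good_pairs S. num_choices S h)"
    by (rule sum_mono) (auto simp: good_pairs_def intro: num_choices_pos[OF S(1)])
  also have "\<dots> \<le> (\<Sum>h\<in>hash_pairs S. num_choices S h)"
    using fin by (intro sum_mono2) (auto simp: good_pairs_def num_choices_def intro!: sum_nonneg)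
  also have "\<dots> = 2 ^ ?n * real ?n ^ ?n * fact ?n"
    using sum_num_choices[OF S(1)] by simp
  also have "\<dots> \<le> 2 ^ ?n * real ?n ^ ?n * (exp 1 * real ?n * real ?n ^ ?n / exp (real ?n))"
    using fact_upper_bound[of ?n] n by (intro mult_left_mono) (auto simp: field_simps)
  finally show ?thesis
    unfolding good_prob_def square_power using n by (simp add: power_divide exp_of_nat_mult[symmetric] field_simps)
qed

lemma good_prob_le_1:
  assumes "finite S"
  shows "good_prob S \<le> 1"
proof -
  have "card (good_pairs S) \<le> card S ^ (2 * card S)"
    unfolding card_hash_pairs[OF assms, symmetric]
    using finite_hash_pairs[OF assms] by (intro card_mono) (auto simp: good_pairs_def)
  then show ?thesis
    unfolding good_prob_def of_nat_power[symmetric] by (cases "card S ^ (2 * card S) = 0") (auto simp del: of_nat_power)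
qed

lemma good_prob_pos:
  assumes "finite S" "S \<noteq> {}"
  shows "good_prob S > 0"
proof -
  have "(0::real) < (2 / exp 1) ^ card S" by simp
  then show ?thesis using good_prob_lower[OF assms] by linarith
qed

subsection \<open>The number of seeds tried\<close>

text \<open>Nonemptiness makes the uniform measure on \<open>{1..card S}\<close> a probability
  measure.\<close>

locale nonempty_key_set =
  fixes S :: "'k set"
  assumes fin: "finite S" and nonempty: "S \<noteq> {}"
begin

abbreviation M where "M \<equiv> hash_space S"

lemma card_pos: "card S > 0"
  using fin nonempty by (simp add: card_gt_0_iff)

lemma prob_space_uniform: "prob_space (uniform_count_measure {1..card S})"
  using card_pos by (intro prob_space_uniform_count_measure) auto

sublocale prob_space M
  unfolding hash_space_def by (intro prob_space_PiM prob_space_uniform)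

section \<open>Joint distribution of the hash values of finitely many seeds\<close>

lemma in_space_iff: "\<omega> \<in> space M \<longleftrightarrow> \<omega> \<in> (UNIV \<times> UNIV \<times> S) \<rightarrow>\<^sub>E {1..card S}"
  by (simp add: hash_space_def space_PiM space_uniform_count_measure)

lemma hashes_in: "\<omega> \<in> space M \<Longrightarrow> hashes \<omega> s \<in> hash_pairs S"
  unfolding in_space_iff hash_pairs_def hashes_def by (auto simp: PiE_iff extensional_def)

text \<open>Outside \<open>S\<close> both functions are \<open>undefined\<close>, so the event
  depends on finitely many coordinates.\<close>

lemma hashes_eq_iff:
  assumes "\<omega> \<in> space M" "g \<in> hash_pairs S"
  shows "hashes \<omega> s = g \<longleftrightarrow> (\<forall>i. \<forall>x\<in>S. \<omega> (s, i, x) = g i x)"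
proof
  assume *: "\<forall>i. \<forall>x\<in>S. \<omega> (s, i, x) = g i x"
  have "\<omega> (s, i, x) = g i x" for i x
  proof (cases "x \<in> S")
    case False
    then have "\<omega> (s, i, x) = undefined" "g i x = undefined"
      using assms unfolding in_space_iff hash_pairs_def by (auto simp: PiE_iff extensional_def)
    then show ?thesis by simp
  qed (use * in blast)
  then show "hashes \<omega> s = g" by (intro ext) (simp add: hashes_def)
qed (auto simp: hashes_def)

lemma measurable_hashes: "(\<lambda>\<omega>. hashes \<omega> s) \<in> M \<rightarrow>\<^sub>M count_space (hash_pairs S)"
proof (subst measurable_count_space_eq2[OF finite_hash_pairs[OF fin]], intro conjI ballI)
  show "(\<lambda>\<omega>. hashes \<omega> s) \<in> space M \<rightarrow> hash_pairs S"
    using hashes_in by blast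
  fix g assume g: "g \<in> hash_pairs S"
  have "{\<omega>\<in>space M. \<omega> (s, i, x) = g i x} \<in> sets M" if "x \<in> S" for i x
  proof -
    have "{y \<in> space (uniform_count_measure {1..card S}). y = g i x} \<in> sets (uniform_count_measure {1..card S})"
      by (auto simp: sets_uniform_count_measure space_uniform_count_measure)
    then show ?thesis
      unfolding hash_space_def using that by (intro sets_Collect_single') auto
  qed
  then have "{\<omega>\<in>space M. \<forall>i\<in>UNIV. \<forall>x\<in>S. \<omega> (s, i, x) = g i x} \<in> sets M"
    using fin by (intro sets.sets_Collect_finite_All) auto
  moreover have "(\<lambda>\<omega>. hashes \<omega> s) -` {g} \<inter> space M = {\<omega>\<in>space M. \<forall>i\<in>UNIV. \<forall>x\<in>S. \<omega> (s, i, x) = g i x}"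
    using hashes_eq_iff[OF _ g] by auto
  ultimately show "(\<lambda>\<omega>. hashes \<omega> s) -` {g} \<inter> space M \<in> sets M" by simp
qed

lemma measurable_of_hashes: "(\<lambda>\<omega>. F (hashes \<omega> s)) \<in> M \<rightarrow>\<^sub>M count_space UNIV"
  by (rule measurable_compose[OF measurable_hashes]) simp

lemma sets_hashes: "{\<omega>\<in>space M. P (hashes \<omega> s)} \<in> sets M"
  using measurable_of_hashes[of P s] by (simp add: pred_def)

text \<open>The event is a cylinder that fixes \<open>2 * card S * card T\<close> independent
  uniform coordinates.\<close>

lemma prob_hashes_eq:
  assumes T: "finite T" and g: "g \<in> T \<rightarrow> hash_pairs S"
  shows "prob {\<omega>\<in>space M. \<forall>s\<in>T. hashes \<omega> s = g s} = (1 / real (card S) ^ (2 * card S)) ^ card T"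
proof -
  let ?I = "UNIV \<times> UNIV \<times> S :: (nat \<times> bool \<times> 'k) set"
  let ?J = "T \<times> (UNIV :: bool set) \<times> S"
  let ?U = "uniform_count_measure {1..card S}"
  interpret U: prob_space ?U by (rule prob_space_uniform)
  interpret P: product_prob_space "\<lambda>_. ?U" ?I by unfold_locales
  have gV: "g s i x \<in> {1..card S}" if "s \<in> T" "x \<in> S" for s i x
  proof -
    have "g s i \<in> S \<rightarrow>\<^sub>E {1..card S}"
      using funcset_mem[OF g that(1)] by (simp add: hash_pairs_def)
    then show ?thesis by (rule PiE_mem[OF _ that(2)])
  qed
  have eq: "{\<omega>\<in>space M. \<forall>s\<in>T. hashes \<omega> s = g s}
      = {\<omega>\<in>space (PiM ?I (\<lambda>_. ?U)). \<forall>j\<in>?J. \<omega> j \<in> {g (fst j) (fst (snd j)) (snd (snd j))}}"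
  proof -
    have "(\<forall>s\<in>T. hashes \<omega> s = g s) \<longleftrightarrow> (\<forall>s\<in>T. \<forall>i. \<forall>x\<in>S. \<omega> (s, i, x) = g s i x)"
      if "\<omega> \<in> space M" for \<omega>
      by (rule ball_cong[OF refl]) (rule hashes_eq_iff[OF that funcset_mem[OF g]])
    then show ?thesis
      unfolding hash_space_def[symmetric] by (intro Collect_cong conj_cong refl) simp
  qed
  have "emeasure M {\<omega>\<in>space M. \<forall>s\<in>T. hashes \<omega> s = g s}
      = (\<Prod>j\<in>?J. emeasure ?U {g (fst j) (fst (snd j)) (snd (snd j))})"
    unfolding eq unfolding hash_space_def using gV fin T
    by (intro P.emeasure_PiM_Collect) (auto simp: sets_uniform_count_measure)
  also have "\<dots> = (\<Prod>j\<in>?J. ennreal (1 / card S))"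
    using gV by (intro prod.cong refl) (auto simp: emeasure_uniform_count_measure)
  also have "\<dots> = ennreal ((1 / card S) ^ card ?J)"
    by (simp add: ennreal_power)
  also have "card ?J = 2 * card S * card T"
    by (simp add: card_cartesian_product)
  finally show ?thesis
    by (simp add: emeasure_eq_measure power_mult power_one_over)
qed

text \<open>The event splits into disjoint, equally likely cylinders, one for each function in
  \<open>T \<rightarrow>\<^sub>E B\<close>. The product form expresses independence across
  seeds.\<close>

lemma prob_hashes_in:
  assumes T: "finite T" and B: "B \<subseteq> hash_pairs S"
  shows "prob {\<omega>\<in>space M. \<forall>s\<in>T. hashes \<omega> s \<in> B} = (card B / real (card S) ^ (2 * card S)) ^ card T"
proof -
  let ?E = "\<lambda>g. {\<omega>\<in>space M. \<forall>s\<in>T. hashes \<omega> s = g s}"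
  have finB: "finite B" using B finite_hash_pairs[OF fin] finite_subset by blast
  have "{\<omega>\<in>space M. \<forall>s\<in>T. hashes \<omega> s \<in> B} = (\<Union>g\<in>T \<rightarrow>\<^sub>E B. ?E g)"
  proof (intro equalityI subsetI)
    fix \<omega> assume "\<omega> \<in> {\<omega>\<in>space M. \<forall>s\<in>T. hashes \<omega> s \<in> B}"
    then have "restrict (hashes \<omega>) T \<in> T \<rightarrow>\<^sub>E B" "\<omega> \<in> ?E (restrict (hashes \<omega>) T)"
      by auto
    then show "\<omega> \<in> (\<Union>g\<in>T \<rightarrow>\<^sub>E B. ?E g)" by blast
  qed auto
  also have "prob \<dots> = (\<Sum>g\<in>T \<rightarrow>\<^sub>E B. prob (?E g))"
  proof (rule finite_measure_finite_Union)
    show "finite (T \<rightarrow>\<^sub>E B)" using T finB by (intro finite_PiE) auto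
    show "?E ` (T \<rightarrow>\<^sub>E B) \<subseteq> sets M"
      using T sets_hashes by (auto intro!: sets.sets_Collect_finite_All)
    show "disjoint_family_on ?E (T \<rightarrow>\<^sub>E B)"
      unfolding disjoint_family_on_def
    proof (intro ballI impI)
      fix g g' assume "g \<in> T \<rightarrow>\<^sub>E B" "g' \<in> T \<rightarrow>\<^sub>E B" "g \<noteq> g'"
      then obtain s where "s \<in> T" "g s \<noteq> g' s" by (meson PiE_ext)
      then show "?E g \<inter> ?E g' = {}" by auto
    qed
  qed
  also have "\<dots> = (\<Sum>g\<in>T \<rightarrow>\<^sub>E B. (1 / real (card S) ^ (2 * card S)) ^ card T)"
    using T B by (intro sum.cong refl prob_hashes_eq) auto
  also have "\<dots> = (card B / real (card S) ^ (2 * card S)) ^ card T"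
    using T by (simp add: card_funcsetE power_divide)
  finally show ?thesis .
qed

section \<open>The waiting time for the first good seed\<close>

definition all_fail :: "nat \<Rightarrow> (nat \<times> bool \<times> 'k \<Rightarrow> nat) set" where
  "all_fail t = {\<omega>\<in>space M. \<forall>s\<in>{..<t}. \<nexists>f. perfect_choice S (hashes \<omega> s) f}"

lemma sets_all_fail [measurable]: "all_fail t \<in> sets M"
  unfolding all_fail_def by (intro sets.sets_Collect_finite_All sets_hashes) auto

lemma prob_all_fail: "prob (all_fail t) = (1 - good_prob S) ^ t"
proof -
  let ?B = "hash_pairs S - good_pairs S"
  have sub: "good_pairs S \<subseteq> hash_pairs S" by (auto simp: good_pairs_def)
  then have finG: "finite (good_pairs S)" using finite_hash_pairs[OF fin] finite_subset by blast
  have "all_fail t = {\<omega>\<in>space M. \<forall>s\<in>{..<t}. hashes \<omega> s \<in> ?B}"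
    unfolding all_fail_def good_pairs_def using hashes_in by auto
  also have "prob \<dots> = (card ?B / real (card S) ^ (2 * card S)) ^ t"
    using prob_hashes_in[of "{..<t}" ?B] by simp
  also have "real (card ?B) = real (card S) ^ (2 * card S) - card (good_pairs S)"
  proof -
    have "card (good_pairs S) \<le> card (hash_pairs S)"
      by (rule card_mono[OF finite_hash_pairs[OF fin] sub])
    then show ?thesis
      using card_Diff_subset[OF finG sub] card_hash_pairs[OF fin] by (simp add: of_nat_diff)
  qed
  finally show ?thesis
    using card_pos by (simp add: good_prob_def diff_divide_distrib)
qed

text \<open>A tail sum, so its expectation is a geometric series. As \<open>all_fail 0\<close> is
  the whole space, it equals the found seed plus one on termination; otherwise it is infinite, which
  lets it dominate space and time everywhere.\<close>

definition num_tries :: "(nat \<times> bool \<times> 'k \<Rightarrow> nat) \<Rightarrow> ennreal" where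
  "num_tries \<omega> = (\<Sum>t. indicator (all_fail t) \<omega>)"

lemma measurable_num_tries [measurable]: "num_tries \<in> borel_measurable M"
  unfolding num_tries_def by measurable

lemma nn_integral_num_tries: "(\<integral>\<^sup>+ \<omega>. num_tries \<omega> \<partial>M) = ennreal (1 / good_prob S)"
proof -
  have "(\<integral>\<^sup>+ \<omega>. num_tries \<omega> \<partial>M) = (\<Sum>t. \<integral>\<^sup>+ \<omega>. indicator (all_fail t) \<omega> \<partial>M)"
    unfolding num_tries_def by (rule nn_integral_suminf) simp
  also have "\<dots> = (\<Sum>t. ennreal ((1 - good_prob S) ^ t))"
    by (simp add: emeasure_eq_measure prob_all_fail)
  also have "\<dots> = ennreal (1 / (1 - (1 - good_prob S)))"
    using good_prob_pos[OF fin nonempty] good_prob_le_1[OF fin]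
    by (intro suminf_ennreal_eq geometric_sums) auto
  finally show ?thesis by simp
qed

lemma found_seed_least:
  assumes "terminates S \<omega>"
  shows "\<exists>f. perfect_choice S (hashes \<omega> (found_seed S \<omega>)) f"
    and "s < found_seed S \<omega> \<Longrightarrow> \<nexists>f. perfect_choice S (hashes \<omega> s) f"
  using assms LeastI_ex[of "\<lambda>s. \<exists>f. perfect_choice S (hashes \<omega> s) f"]
    not_less_Least[of s "\<lambda>s. \<exists>f. perfect_choice S (hashes \<omega> s) f"]
  unfolding terminates_def found_seed_def by blast+

lemma all_fail_iff:
  assumes "\<omega> \<in> space M" "terminates S \<omega>"
  shows "\<omega> \<in> all_fail t \<longleftrightarrow> t \<le> found_seed S \<omega>"
  using assms found_seed_least[OF assms(2)] unfolding all_fail_def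
  by (auto simp: not_less[symmetric] intro: order.strict_trans2)

lemma num_tries_eq:
  assumes "\<omega> \<in> space M" "terminates S \<omega>"
  shows "num_tries \<omega> = of_nat (found_seed S \<omega> + 1)"
proof -
  have "num_tries \<omega> = (\<Sum>t\<in>{..found_seed S \<omega>}. indicator (all_fail t) \<omega>)"
    unfolding num_tries_def by (rule suminf_finite) (auto simp: indicator_def all_fail_iff[OF assms])
  also have "\<dots> = (\<Sum>t\<in>{..found_seed S \<omega>}. 1)"
    by (intro sum.cong refl) (simp add: indicator_def all_fail_iff[OF assms])
  finally show ?thesis by simp
qed

lemma num_tries_infinite:
  assumes "\<omega> \<in> space M" "\<not> terminates S \<omega>"
  shows "num_tries \<omega> = \<infinity>"
proof -
  have "\<omega> \<in> all_fail t" for t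
    using assms unfolding all_fail_def terminates_def by blast
  then have "(\<Sum>t<n. indicator (all_fail t) \<omega>) = (of_nat n :: ennreal)" for n
    by simp
  then have "of_nat n \<le> num_tries \<omega>" for n
    unfolding num_tries_def by (metis sum_le_suminf summableI finite_lessThan zero_le)
  then show ?thesis
    using ennreal_Ex_less_of_nat[of "num_tries \<omega>"] by (metis infinity_ennreal_def leD top.not_eq_extremum)
qed

text \<open>\<open>num_tries\<close> has finite expectation but is infinite wherever no seed
  works.\<close>

lemma AE_terminates: "AE \<omega> in M. terminates S \<omega>"
proof -
  have "AE \<omega> in M. num_tries \<omega> \<noteq> \<infinity>"
    by (rule nn_integral_PInf_AE) (simp_all add: nn_integral_num_tries)
  then show ?thesis
    using num_tries_infinite by (auto elim!: AE_mp)
qed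

text \<open>The found seed is a measurable index with countably many values, so measurability for
  each fixed seed suffices.\<close>

lemma measurable_of_found_seed:
  assumes "\<And>s. (\<lambda>\<omega>. F s \<omega>) \<in> M \<rightarrow>\<^sub>M N"
  shows "(\<lambda>\<omega>. F (found_seed S \<omega>) \<omega>) \<in> M \<rightarrow>\<^sub>M N"
proof (rule measurable_compose_countable'[OF assms])
  show "found_seed S \<in> M \<rightarrow>\<^sub>M count_space UNIV"
    unfolding found_seed_def by (intro measurable_Least measurable_of_hashes)
qed auto

lemma sets_terminates: "{\<omega>\<in>space M. terminates S \<omega>} \<in> sets M"
  unfolding terminates_def by (intro sets.sets_Collect_countable_Ex sets_hashes)

lemma measurable_space_usage: "space_usage test build S \<in> borel_measurable M"
proof -
  have "(\<lambda>\<omega>. of_nat (stored_bits (s, build S (the (test S (hashes \<omega> s))))) :: ennreal) \<in> borel_measurable M" for s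
    by (rule measurable_compose[OF measurable_of_hashes]) simp
  from measurable_of_found_seed[OF this] show ?thesis
    unfolding space_usage_def[abs_def] shockhash_def found_choice_def
    by (intro measurable_If sets_terminates) auto
qed

lemma measurable_construction_time:
  "construction_time test test_cost build_cost S \<in> borel_measurable M"
proof -
  have "(\<lambda>\<omega>. of_nat ((\<Sum>i\<le>s. test_cost S (hashes \<omega> i)) + build_cost S (the (test S (hashes \<omega> s)))) :: ennreal)
      \<in> borel_measurable M" for s
    unfolding of_nat_add of_nat_sum
    by (intro borel_measurable_add borel_measurable_sum measurable_compose[OF measurable_of_hashes]) simp_all
  from measurable_of_found_seed[OF this] show ?thesis
    unfolding construction_time_def[abs_def] found_choice_def
    by (intro measurable_If sets_terminates) auto
qed

end

subsection \<open>Expected space and time\<close>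

text \<open>Using \<open>Suc s\<close> avoids the logarithm of 0 for the first seed and matches
  \<open>num_tries\<close>.\<close>

lemma log2_Suc_le_floorlog: "log 2 (real (Suc s)) \<le> real (floorlog 2 s)"
proof -
  have "s < 2 ^ floorlog 2 s" by (rule floorlog_leD) auto
  then have "real (Suc s) \<le> 2 ^ floorlog 2 s"
    by (metis Suc_leI of_nat_le_iff of_nat_numeral of_nat_power)
  then show ?thesis
    by (subst log_le_iff) (auto simp: powr_realpow)
qed

lemma floorlog_le_log2_Suc: "real (floorlog 2 s) \<le> 1 + log 2 (real (Suc s))"
proof (cases "s = 0")
  case True
  then show ?thesis by (simp add: floorlog_def)
next
  case False
  then have "2 ^ (floorlog 2 s - 1) \<le> s" using floorlog_bounds[of s 2] by simp
  then have "(2::real) ^ (floorlog 2 s - 1) \<le> real (Suc s)"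
    by (metis le_SucI of_nat_le_iff of_nat_numeral of_nat_power)
  then have "real (floorlog 2 s - 1) \<le> log 2 (real (Suc s))"
    by (subst le_log_iff) (auto simp: powr_realpow)
  then show ?thesis by linarith
qed

text \<open>The tangent of the logarithm at \<open>T\<close>, with a constant dropped. It replaces
  Jensen's inequality: the right-hand side is affine in \<open>x\<close> and is integrated with
  \<open>x\<close> the number of tries.\<close>

lemma log2_le_tangent:
  assumes "x > 0" "T > 0"
  shows "log 2 x \<le> log 2 T + x / (T * ln 2)"
proof -
  have "ln (x / T) \<le> x / T - 1"
    using assms by (intro ln_le_minus_one) simp
  then have "ln x \<le> ln T + x / T"
    using assms by (simp add: ln_div)
  then have "ln x / ln 2 \<le> (ln T + x / T) / ln 2"
    by (intro divide_right_mono) auto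
  then show ?thesis
    by (simp add: log_def add_divide_distrib)
qed

context nonempty_key_set
begin

lemma found_choice_perfect:
  assumes "seed_test test" "\<omega> \<in> space M" "terminates S \<omega>"
  shows "perfect_choice S (hashes \<omega> (found_seed S \<omega>)) (found_choice test S \<omega>)"
proof -
  let ?h = "hashes \<omega> (found_seed S \<omega>)"
  have "hash_pair S ?h" using hashes_in[OF assms(2)] by (rule hash_pairsD)
  then have "case test S ?h of None \<Rightarrow> \<not> (\<exists>f. perfect_choice S ?h f) | Some f \<Rightarrow> perfect_choice S ?h f"
    using assms(1) fin unfolding seed_test_def by blast
  then show ?thesis
    using found_seed_least(1)[OF assms(3)] unfolding found_choice_def by (auto split: option.splits)
qed

lemma AE_query_bij:
  assumes "seed_test test" "retrieval build query"
  shows "AE \<omega> in M. terminates S \<omega> \<and>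
    bij_betw (shockhash_query query S \<omega> (shockhash test build S \<omega>)) S {1..card S}"
  using AE_terminates AE_space
proof eventually_elim
  case (elim \<omega>)
  have "shockhash_query query S \<omega> (shockhash test build S \<omega>) x
      = hashes \<omega> (found_seed S \<omega>) (found_choice test S \<omega> x) x" if "x \<in> S" for x
    using assms(2) fin that unfolding retrieval_def shockhash_query_def shockhash_def by simp
  then have "bij_betw (shockhash_query query S \<omega> (shockhash test build S \<omega>)) S {1..card S}"
    using found_choice_perfect[OF assms(1)] elim
    unfolding perfect_choice_def by (subst bij_betw_cong) auto
  then show ?case using elim by blast
qed

section \<open>Expected number of tries and its logarithm\<close>

lemma inverse_good_prob_le: "1 / good_prob S \<le> (exp 1 / 2) ^ card S"
proof -
  have "1 / good_prob S \<le> 1 / (2 / exp 1) ^ card S"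
    using good_prob_lower[OF fin nonempty] good_prob_pos[OF fin nonempty] by (intro divide_left_mono) auto
  then show ?thesis by (simp add: power_divide)
qed

text \<open>This is the share of the seed in the space; the \<open>n\<close> retrieval bits raise it
  to \<open>n * log 2 (exp 1)\<close>.\<close>

lemma log2_inverse_good_prob_le: "log 2 (1 / good_prob S) \<le> real (card S) * (log 2 (exp 1) - 1)"
proof -
  have "log 2 (1 / good_prob S) \<le> log 2 ((exp 1 / 2) ^ card S)"
    using inverse_good_prob_le good_prob_pos[OF fin nonempty] by (intro log_mono) auto
  also have "\<dots> = real (card S) * (log 2 (exp 1) - 1)"
    by (simp add: log_nat_power log_divide)
  finally show ?thesis .
qed

lemma log2_inverse_good_prob_ge:
  "log 2 (1 / good_prob S) \<ge> real (card S) * (log 2 (exp 1) - 1) - log 2 (exp 1) - log 2 (real (card S))"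
proof -
  let ?n = "real (card S)"
  have "log 2 (good_prob S) \<le> log 2 (exp 1 * ?n * (2 / exp 1) ^ card S)"
    using good_prob_upper[OF fin nonempty] good_prob_pos[OF fin nonempty] by (intro log_mono) auto
  also have "\<dots> = log 2 (exp 1) + log 2 ?n + ?n * (1 - log 2 (exp 1))"
    using card_pos by (simp add: log_mult log_nat_power log_divide)
  finally show ?thesis
    using good_prob_pos[OF fin nonempty] by (simp add: log_divide algebra_simps)
qed

lemma expected_space_le:
  assumes "\<And>f. real (length (build S f)) \<le> b"
  shows "(\<integral>\<^sup>+ \<omega>. space_usage test build S \<omega> \<partial>M)
    \<le> ennreal (b + real (card S) * (log 2 (exp 1) - 1) + 1 + 1 / ln 2)"
proof -
  define p where "p = good_prob S"
  have p: "0 < p" "p \<le> 1"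
    using good_prob_pos[OF fin nonempty] good_prob_le_1[OF fin] by (simp_all add: p_def)
  \<comment> \<open>The part of the bound that does not depend on the seed; the 1 pays for rounding
    in \<open>floorlog\<close>.\<close>
  define K where "K = b + 1 + log 2 (1 / p)"
  have "0 \<le> b" using assms[of undefined] by linarith
  moreover have "0 \<le> log 2 (1 / p)" using p by simp
  ultimately have K: "K \<ge> 0" by (simp add: K_def)
  \<comment> \<open>The tangent is taken at \<open>1 / p\<close>, the expectation of
    \<open>num_tries\<close>, so the second term integrates to exactly
    \<open>1 / ln 2\<close>.\<close>
  have "space_usage test build S \<omega> \<le> ennreal K + ennreal (p / ln 2) * num_tries \<omega>"
    if \<omega>: "\<omega> \<in> space M" for \<omega>
  proof (cases "terminates S \<omega>")
    case True
    let ?s = "found_seed S \<omega>"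
    have "real (floorlog 2 ?s) \<le> 1 + (log 2 (1 / p) + real (Suc ?s) / (1 / p * ln 2))"
      using floorlog_le_log2_Suc[of ?s] log2_le_tangent[of "real (Suc ?s)" "1 / p"] p by simp
    then have "real (stored_bits (shockhash test build S \<omega>)) \<le> K + p / ln 2 * real (?s + 1)"
      using assms[of "found_choice test S \<omega>"]
      by (simp add: K_def stored_bits_def shockhash_def mult_ac)
    then have "ennreal (real (stored_bits (shockhash test build S \<omega>))) \<le> ennreal (K + p / ln 2 * real (?s + 1))"
      by (rule ennreal_leI)
    also have "\<dots> = ennreal K + ennreal (p / ln 2) * num_tries \<omega>"
      unfolding num_tries_eq[OF \<omega> True] ennreal_of_nat_eq_real_of_nat using K p
      by (subst ennreal_plus, simp, simp, subst ennreal_mult) simp_all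
    finally show ?thesis
      using True by (simp add: space_usage_def ennreal_of_nat_eq_real_of_nat)
  next
    case False
    then show ?thesis
      using num_tries_infinite[OF \<omega>] p by (simp add: ennreal_mult_top)
  qed
  then have "(\<integral>\<^sup>+ \<omega>. space_usage test build S \<omega> \<partial>M)
      \<le> (\<integral>\<^sup>+ \<omega>. ennreal K + ennreal (p / ln 2) * num_tries \<omega> \<partial>M)"
    by (rule nn_integral_mono)
  also have "\<dots> = ennreal K + ennreal (p / ln 2) * ennreal (1 / p)"
    by (simp add: nn_integral_add nn_integral_cmult nn_integral_num_tries emeasure_space_1 p_def)
  also have "\<dots> = ennreal (K + p / ln 2 * (1 / p))"
    using K p by (simp add: ennreal_plus ennreal_mult[symmetric])
  also have "\<dots> \<le> ennreal (b + real (card S) * (log 2 (exp 1) - 1) + 1 + 1 / ln 2)"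
    using log2_inverse_good_prob_le p by (intro ennreal_leI) (simp add: K_def p_def)
  finally show ?thesis .
qed

lemma expected_space_ge:
  assumes "\<And>f. a \<le> real (length (build S f))"
  shows "ennreal (a + real (card S) * (log 2 (exp 1) - 1) - 2 * log 2 (exp 1) - 2 * log 2 (real (card S)))
    \<le> (\<integral>\<^sup>+ \<omega>. space_usage test build S \<omega> \<partial>M)"
proof -
  define p where "p = good_prob S"
  define n where "n = real (card S)"
  \<comment> \<open>A compromise: \<open>m * p \<le> 1 / n\<close> makes it likely that the first
    \<open>m\<close> seeds all fail, while \<open>log 2 (Suc m)\<close> is still at least
    \<open>log 2 (1 / p) - log 2 n\<close>.\<close>
  define m where "m = nat \<lfloor>1 / (p * n)\<rfloor>"
  define y where "y = log 2 (real (Suc m))"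
  have p: "0 < p" "p \<le> 1"
    using good_prob_pos[OF fin nonempty] good_prob_le_1[OF fin] by (simp_all add: p_def)
  have n: "n \<ge> 1" using card_pos by (simp add: n_def)
  have y0: "y \<ge> 0" by (simp add: y_def)
  have pn: "1 / (p * n) > 0" using p n by simp
  have m: "real m \<le> 1 / (p * n)" "1 / (p * n) \<le> real (Suc m)"
    unfolding m_def using pn by linarith+
  \<comment> \<open>If the first \<open>m\<close> seeds fail, then the found seed is at least
    \<open>m\<close> and takes at least \<open>y\<close> bits.\<close>
  have pointwise: "ennreal a + ennreal y * indicator (all_fail m) \<omega> \<le> space_usage test build S \<omega>"
    if \<omega>: "\<omega> \<in> space M" for \<omega>
  proof (cases "terminates S \<omega>")
    case True
    let ?s = "found_seed S \<omega>"
    have "y * indicator (all_fail m) \<omega> \<le> real (floorlog 2 ?s)"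
    proof (cases "\<omega> \<in> all_fail m")
      case in_fail: True
      then have "y \<le> log 2 (real (Suc ?s))"
        unfolding y_def using all_fail_iff[OF \<omega> True] by (intro log_mono) auto
      then show ?thesis using log2_Suc_le_floorlog[of ?s] in_fail by simp
    qed simp
    moreover have "a \<le> real (length (build S (found_choice test S \<omega>)))" by (rule assms)
    ultimately have "ennreal a + ennreal (y * indicator (all_fail m) \<omega>)
        \<le> ennreal (real (length (build S (found_choice test S \<omega>)))) + ennreal (real (floorlog 2 ?s))"
      by (intro add_mono ennreal_leI)
    then show ?thesis
      using True y0 by (simp add: space_usage_def stored_bits_def shockhash_def
        ennreal_of_nat_eq_real_of_nat ennreal_mult ennreal_indicator add.commute)
  qed (simp add: space_usage_def)
  have "1 - 1 / n \<le> 1 + real m * (- p)"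
    using mult_right_mono[OF m(1), of p] p n by simp
  also have "\<dots> \<le> (1 + - p) ^ m"
    using p by (intro Bernoulli_inequality) simp
  finally have pw: "1 - 1 / n \<le> (1 - p) ^ m" by simp
  \<comment> \<open>An upper bound on \<open>y\<close> is needed too: discarding an event of
    probability up to \<open>1 / n\<close> loses up to \<open>y / n\<close>, which has to stay
    bounded.\<close>
  have "y \<le> log 2 (2 / p)"
  proof -
    have "1 / (p * n) \<le> 1 / p" "1 \<le> 1 / p"
      using p n by (simp_all add: field_simps)
    then have "real (Suc m) \<le> 2 / p" using m(1) by simp
    then show ?thesis unfolding y_def using p by (intro log_mono) auto
  qed
  also have "\<dots> = 1 + log 2 (1 / p)"
    using p by (simp add: log_divide)
  also have "\<dots> \<le> n + n * (log 2 (exp 1) - 1)"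
    using log2_inverse_good_prob_le n by (simp add: p_def n_def)
  finally have "y / n \<le> log 2 (exp 1)"
    using n by (simp add: field_simps)
  moreover have "log 2 (1 / p) - log 2 n \<le> y"
  proof -
    have "log 2 (1 / p) - log 2 n = log 2 (1 / (p * n))"
      using p n by (simp add: log_divide log_mult)
    also have "\<dots> \<le> y"
      unfolding y_def using m(2) pn by (intro log_mono) auto
    finally show ?thesis .
  qed
  moreover have "y * (1 - 1 / n) \<le> y * (1 - p) ^ m"
    using pw y0 by (rule mult_left_mono)
  \<comment> \<open>One \<open>log 2 (exp 1)\<close> and one \<open>log 2 n\<close> are lost in
    \<open>log2_inverse_good_prob_ge\<close>, another \<open>log 2 n\<close> in the choice of
    \<open>m\<close>, and another \<open>log 2 (exp 1)\<close> through \<open>y / n\<close>.\<close>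
  ultimately have bound: "n * (log 2 (exp 1) - 1) - 2 * log 2 (exp 1) - 2 * log 2 n \<le> y * (1 - p) ^ m"
    using log2_inverse_good_prob_ge by (simp add: p_def n_def algebra_simps)
  have "ennreal (a + n * (log 2 (exp 1) - 1) - 2 * log 2 (exp 1) - 2 * log 2 n)
      \<le> ennreal (a + y * (1 - p) ^ m)"
    using bound by (intro ennreal_leI) simp
  also have "\<dots> \<le> ennreal a + ennreal (y * (1 - p) ^ m)"
  \<comment> \<open>The lower bound \<open>a\<close> may be negative, in which case
    \<open>ennreal a\<close> is 0.\<close>
  proof (cases "a \<ge> 0")
    case False
    then show ?thesis by (simp add: ennreal_neg ennreal_leI)
  qed (use y0 p in \<open>simp add: ennreal_plus\<close>)
  also have "\<dots> = (\<integral>\<^sup>+ \<omega>. ennreal a + ennreal y * indicator (all_fail m) \<omega> \<partial>M)"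
  proof -
    have "emeasure M (all_fail m) = ennreal ((1 - p) ^ m)"
      by (simp add: emeasure_eq_measure prob_all_fail p_def)
    then show ?thesis
      using y0 p by (simp add: nn_integral_add nn_integral_cmult emeasure_space_1 ennreal_mult)
  qed
  also have "\<dots> \<le> (\<integral>\<^sup>+ \<omega>. space_usage test build S \<omega> \<partial>M)"
    using pointwise by (rule nn_integral_mono)
  finally show ?thesis by (simp add: n_def)
qed

text \<open>The seeds up to and including the found one are tested, so there are
  \<open>num_tries\<close> tests of linear cost, followed by a single linear build.\<close>

lemma expected_time_le:
  assumes test: "\<And>h. hash_pair S h \<Longrightarrow> test_cost S h \<le> c * card S"
    and build: "\<And>f. build_cost S f \<le> d * card S"
  shows "(\<integral>\<^sup>+ \<omega>. construction_time test test_cost build_cost S \<omega> \<partial>M)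
    \<le> ennreal ((real c + 1 + real d) * ((exp 1 / 2) ^ card S * real (card S)))"
proof -
  define p where "p = good_prob S"
  have p: "0 < p" "p \<le> 1"
    using good_prob_pos[OF fin nonempty] good_prob_le_1[OF fin] by (simp_all add: p_def)
  let ?n = "real (card S)"
  have "construction_time test test_cost build_cost S \<omega>
      \<le> ennreal ((real c + 1) * ?n) * num_tries \<omega> + ennreal (real d * ?n)"
    if \<omega>: "\<omega> \<in> space M" for \<omega>
  proof (cases "terminates S \<omega>")
    case True
    let ?s = "found_seed S \<omega>"
    have "(\<Sum>s\<le>?s. test_cost S (hashes \<omega> s)) \<le> (\<Sum>s\<le>?s. (c + 1) * card S)"
      using test[OF hash_pairsD[OF hashes_in[OF \<omega>]]] by (intro sum_mono) (simp add: trans_le_add2)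
    then have "(\<Sum>s\<le>?s. test_cost S (hashes \<omega> s)) + build_cost S (found_choice test S \<omega>)
        \<le> (c + 1) * card S * (?s + 1) + d * card S"
      using build[of "found_choice test S \<omega>"] by (simp add: mult_ac)
    then have "real ((\<Sum>s\<le>?s. test_cost S (hashes \<omega> s)) + build_cost S (found_choice test S \<omega>))
        \<le> real ((c + 1) * card S * (?s + 1) + d * card S)"
      by (rule of_nat_mono)
    also have "\<dots> = (real c + 1) * ?n * real (?s + 1) + real d * ?n"
      by (simp add: algebra_simps)
    finally show ?thesis
      unfolding num_tries_eq[OF \<omega> True] construction_time_def using True
      by (simp add: ennreal_of_nat_eq_real_of_nat ennreal_mult[symmetric] ennreal_plus[symmetric] ennreal_leI
        del: ennreal_plus of_nat_add of_nat_sum)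
  next
    case False
    then show ?thesis
      using num_tries_infinite[OF \<omega>] card_pos by (simp add: ennreal_mult_top)
  qed
  then have "(\<integral>\<^sup>+ \<omega>. construction_time test test_cost build_cost S \<omega> \<partial>M)
      \<le> (\<integral>\<^sup>+ \<omega>. ennreal ((real c + 1) * ?n) * num_tries \<omega> + ennreal (real d * ?n) \<partial>M)"
    by (rule nn_integral_mono)
  also have "\<dots> = ennreal ((real c + 1) * ?n) * ennreal (1 / p) + ennreal (real d * ?n)"
    by (simp add: nn_integral_add nn_integral_cmult nn_integral_num_tries emeasure_space_1 p_def)
  also have "\<dots> = ennreal ((real c + 1) * ?n * (1 / p) + real d * ?n * 1)"
    using p by (simp add: ennreal_mult[symmetric] ennreal_plus[symmetric] del: ennreal_plus)
  also have "\<dots> \<le> ennreal ((real c + 1) * ?n * (exp 1 / 2) ^ card S + real d * ?n * (exp 1 / 2) ^ card S)"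
  \<comment> \<open>The single build is absorbed because
    \<open>1 \<le> 1 / p \<le> (e/2) ^ n\<close>.\<close>
  proof (intro ennreal_leI add_mono mult_left_mono)
    show "1 / p \<le> (exp 1 / 2) ^ card S" using inverse_good_prob_le by (simp add: p_def)
    moreover have "1 \<le> 1 / p" using p by simp
    ultimately show "1 \<le> (exp 1 / 2 :: real) ^ card S" by linarith
  qed auto
  also have "\<dots> = ennreal ((real c + 1 + real d) * ((exp 1 / 2) ^ card S * ?n))"
    by (simp add: algebra_simps)
  finally show ?thesis .
qed

end

text \<open>All error functions are chosen before \<open>S\<close>, so the bounds are uniform over
  key sets of equal size.\<close>

theorem theorem5p6:
  fixes test :: "'k set \<Rightarrow> (bool \<Rightarrow> 'k \<Rightarrow> nat) \<Rightarrow> ('k \<Rightarrow> bool) option"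
    and test_cost :: "'k set \<Rightarrow> (bool \<Rightarrow> 'k \<Rightarrow> nat) \<Rightarrow> nat"
    and build :: "'k set \<Rightarrow> ('k \<Rightarrow> bool) \<Rightarrow> bool list"
    and query :: "'k set \<Rightarrow> bool list \<Rightarrow> 'k \<Rightarrow> bool"
    and build_cost :: "'k set \<Rightarrow> ('k \<Rightarrow> bool) \<Rightarrow> nat"
  assumes test: "seed_test test"
    and test_linear: "\<exists>c. \<forall>S h. finite S \<and> S \<noteq> {} \<and> hash_pair S h \<longrightarrow> test_cost S h \<le> c * card S"
    and retrieval: "retrieval build query"
    and build_linear: "\<exists>c. \<forall>S f. finite S \<and> S \<noteq> {} \<longrightarrow> build_cost S f \<le> c * card S"
    and retrieval_bits: "\<exists>\<rho>\<in>o(\<lambda>n. real n). \<forall>S f. finite S \<and> S \<noteq> {} \<longrightarrow>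
          real (length (build S f)) \<le> real (card S) + \<rho> (card S)"
  shows
    \<comment> \<open>a seed works iff its multigraph is a pseudoforest\<close>
    "(\<forall>(S :: 'k set) h. finite S \<and> hash_pair S h \<longrightarrow>
        ((\<exists>f. perfect_choice S h f) \<longleftrightarrow> pseudoforest {1..card S} S (h False) (h True)))
    \<and>
    \<comment> \<open>the result is a minimal perfect hash function, almost surely\<close>
    (\<forall>S :: 'k set. finite S \<and> S \<noteq> {} \<longrightarrow>
       (AE \<omega> in hash_space S. terminates S \<omega> \<and>
          bij_betw (shockhash_query query S \<omega> (shockhash test build S \<omega>)) S {1..card S}))
    \<and>
    \<comment> \<open>expected space\<close>
    (\<exists>\<sigma>\<in>o(\<lambda>n. real n). \<forall>S :: 'k set. finite S \<and> S \<noteq> {} \<longrightarrow>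
       space_usage test build S \<in> borel_measurable (hash_space S) \<and>
       (\<integral>\<^sup>+ \<omega>. space_usage test build S \<omega> \<partial>hash_space S)
          \<le> ennreal (log 2 (exp 1) * real (card S) + \<sigma> (card S)))
    \<and>
    \<comment> \<open>matching lower bound, if the retrieval data structure also uses at least n - o(n) bits\<close>
    ((\<exists>\<rho>\<in>o(\<lambda>n. real n). \<forall>S f. finite S \<and> S \<noteq> {} \<longrightarrow>
          real (card S) - \<rho> (card S) \<le> real (length (build S f))) \<longrightarrow>
     (\<exists>\<sigma>\<in>o(\<lambda>n. real n). \<forall>S :: 'k set. finite S \<and> S \<noteq> {} \<longrightarrow>
       ennreal (log 2 (exp 1) * real (card S) - \<sigma> (card S))
          \<le> (\<integral>\<^sup>+ \<omega>. space_usage test build S \<omega> \<partial>hash_space S)))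
    \<and>
    \<comment> \<open>expected construction time\<close>
    (\<exists>\<tau>\<in>O(\<lambda>n. (exp 1 / 2) ^ n * real n). \<forall>S :: 'k set. finite S \<and> S \<noteq> {} \<longrightarrow>
       construction_time test test_cost build_cost S \<in> borel_measurable (hash_space S) \<and>
       (\<integral>\<^sup>+ \<omega>. construction_time test test_cost build_cost S \<omega> \<partial>hash_space S)
          \<le> ennreal (\<tau> (card S)))"
proof (intro conjI impI)
  show "\<forall>(S :: 'k set) h. finite S \<and> hash_pair S h \<longrightarrow>
      ((\<exists>f. perfect_choice S h f) \<longleftrightarrow> pseudoforest {1..card S} S (h False) (h True))"
    using perfect_choice_iff_pseudoforest by blast
next
  show "\<forall>S :: 'k set. finite S \<and> S \<noteq> {} \<longrightarrow>
      (AE \<omega> in hash_space S. terminates S \<omega> \<and>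
        bij_betw (shockhash_query query S \<omega> (shockhash test build S \<omega>)) S {1..card S})"
    using nonempty_key_set.AE_query_bij[OF _ test retrieval] by (simp add: nonempty_key_set_def)
next
  obtain \<rho> where \<rho>: "\<rho> \<in> o(\<lambda>n. real n)"
    and len: "\<And>S f. finite S \<and> S \<noteq> {} \<Longrightarrow> real (length (build S f)) \<le> real (card S) + \<rho> (card S)"
    using retrieval_bits by blast
  \<comment> \<open>Beyond the retrieval overhead, the excess is 1 bit of rounding and the
    \<open>1 / ln 2\<close> of the tangent bound.\<close>
  let ?\<sigma> = "\<lambda>n. \<rho> n + (1 + 1 / ln 2)"
  have "(\<lambda>n. 1 + 1 / ln 2 :: real) \<in> o(\<lambda>n. real n)" by real_asymp
  then have \<sigma>: "?\<sigma> \<in> o(\<lambda>n. real n)" by (rule sum_in_smallo(1)[OF \<rho>])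
  show "\<exists>\<sigma>\<in>o(\<lambda>n. real n). \<forall>S :: 'k set. finite S \<and> S \<noteq> {} \<longrightarrow>
      space_usage test build S \<in> borel_measurable (hash_space S) \<and>
      (\<integral>\<^sup>+ \<omega>. space_usage test build S \<omega> \<partial>hash_space S)
        \<le> ennreal (log 2 (exp 1) * real (card S) + \<sigma> (card S))"
  proof (rule bexI[OF _ \<sigma>], intro allI impI conjI)
    fix S :: "'k set" assume S: "finite S \<and> S \<noteq> {}"
    interpret nonempty_key_set S by unfold_locales (use S in auto)
    show "space_usage test build S \<in> borel_measurable (hash_space S)"
      by (rule measurable_space_usage)
    show "(\<integral>\<^sup>+ \<omega>. space_usage test build S \<omega> \<partial>hash_space S)
        \<le> ennreal (log 2 (exp 1) * real (card S) + ?\<sigma> (card S))"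
      using expected_space_le[of build, OF len[OF S]] by (simp add: algebra_simps)
  qed
next
  assume "\<exists>\<rho>\<in>o(\<lambda>n. real n). \<forall>S f. finite S \<and> S \<noteq> {} \<longrightarrow>
      real (card S) - \<rho> (card S) \<le> real (length (build S f))"
  then obtain \<rho> where \<rho>: "\<rho> \<in> o(\<lambda>n. real n)"
    and len: "\<And>S f. finite S \<and> S \<noteq> {} \<Longrightarrow> real (card S) - \<rho> (card S) \<le> real (length (build S f))"
    by blast
  let ?\<sigma> = "\<lambda>n. \<rho> n + (2 * log 2 (exp 1) + 2 * log 2 (real n))"
  have "(\<lambda>n. 2 * log 2 (exp 1) + 2 * log 2 (real n)) \<in> o(\<lambda>n. real n)"
    unfolding log_def by real_asymp
  then have \<sigma>: "?\<sigma> \<in> o(\<lambda>n. real n)" by (rule sum_in_smallo(1)[OF \<rho>])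
  show "\<exists>\<sigma>\<in>o(\<lambda>n. real n). \<forall>S :: 'k set. finite S \<and> S \<noteq> {} \<longrightarrow>
      ennreal (log 2 (exp 1) * real (card S) - \<sigma> (card S))
        \<le> (\<integral>\<^sup>+ \<omega>. space_usage test build S \<omega> \<partial>hash_space S)"
  proof (rule bexI[OF _ \<sigma>], intro allI impI)
    fix S :: "'k set" assume S: "finite S \<and> S \<noteq> {}"
    interpret nonempty_key_set S by unfold_locales (use S in auto)
    show "ennreal (log 2 (exp 1) * real (card S) - ?\<sigma> (card S))
        \<le> (\<integral>\<^sup>+ \<omega>. space_usage test build S \<omega> \<partial>hash_space S)"
      using expected_space_ge[of _ build test, OF len[OF S]] by (simp add: algebra_simps)
  qed
next
  obtain c where c: "\<And>S h. finite S \<and> S \<noteq> {} \<and> hash_pair S h \<Longrightarrow> test_cost S h \<le> c * card S"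
    using test_linear by blast
  obtain d where d: "\<And>S f. finite S \<and> S \<noteq> {} \<Longrightarrow> build_cost S f \<le> d * card S"
    using build_linear by blast
  let ?\<tau> = "\<lambda>n. (real c + 1 + real d) * ((exp 1 / 2) ^ n * real n)"
  have \<tau>: "?\<tau> \<in> O(\<lambda>n. (exp 1 / 2) ^ n * real n)" by simp
  show "\<exists>\<tau>\<in>O(\<lambda>n. (exp 1 / 2) ^ n * real n). \<forall>S :: 'k set. finite S \<and> S \<noteq> {} \<longrightarrow>
      construction_time test test_cost build_cost S \<in> borel_measurable (hash_space S) \<and>
      (\<integral>\<^sup>+ \<omega>. construction_time test test_cost build_cost S \<omega> \<partial>hash_space S)
        \<le> ennreal (\<tau> (card S))"
  proof (rule bexI[OF _ \<tau>], intro allI impI conjI)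
    fix S :: "'k set" assume S: "finite S \<and> S \<noteq> {}"
    interpret nonempty_key_set S by unfold_locales (use S in auto)
    show "construction_time test test_cost build_cost S \<in> borel_measurable (hash_space S)"
      by (rule measurable_construction_time)
    show "(\<integral>\<^sup>+ \<omega>. construction_time test test_cost build_cost S \<omega> \<partial>hash_space S)
        \<le> ennreal (?\<tau> (card S))"
      using c d S by (intro expected_time_le) auto
  qed
qed

end
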